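(* Let $n\ge 2$. For generic $n\times n$ symmetric matrices $A$ and $B$, the maximum likelihood degree of the two-dimensional linear Gaussian covariance model $\mathcal{M}_{A,B}=\{xA+yB \mid x,y\in\mathbb{R}\}\cap \mathrm{PD}_n$ is $2n-3$. Here "generic" means that there is a nonempty Zariski open subset $U$ of the space of pairs of $n\times n$ symmetric matrices such that the assertion holds for all $(A,B)\in U$ that define a model (that is, $A,B$ real with $\mathcal{M}_{A,B}\neq\emptyset$).
   Context: $\mathrm{PD}_n$ is the cone of real symmetric positive definite $n\times n$ matrices. For symmetric $n\times n$ matrices $A,B$, put $\Sigma=\Sigma(x,y)=xA+yB$, and for a symmetric matrix $S$ (the sample covariance matrix) let $P(x,y)=\det\Sigma$ and $T(x,y)=\operatorname{tr}(S\,\operatorname{adj}\Sigma)$, where $\operatorname{adj}$ is the classical adjoint (adjugate). Subscripts denote partial derivatives. Maximizing the Gaussian log-likelihood on $\mathcal{M}_{A,B}$ is equivalent to minimizing $\tilde\ell(x,y)=\log\det\Sigma+\operatorname{tr}(S\Sigma^{-1})=\log P+T/P$. The score equations are the equations $\tilde\ell_x=0$, $\tilde\ell_y=0$, where $$\tilde\ell_x=\frac{P_x}{P}+\frac{PT_x-TP_x}{P^2},\qquad \tilde\ell_y=\frac{P_y}{P}+\frac{PT_y-TP_y}{P^2}.$$ The maximum likelihood degree (ML-degree) of $\mathcal{M}_{A,B}$ is the number of complex solutions $(x,y)\in\mathbb{C}^2$ (with $P(x,y)\ne 0$) of the score equations, counted with multiplicity, for generic $S$ (this number is the same for all $S$ in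 some nonempty Zariski open subset of the space of symmetric $n\times n$ matrices). Equivalently, with $f=PP_x+PT_x-TP_x$ and $g=PP_y+PT_y-TP_y$, it is the degree $\dim_{\mathbb{C}}\mathbb{C}[x,y]/J$ of the (zero-dimensional) saturation ideal $J=\langle f,g\rangle:\langle P\rangle^\infty=\{h\in\mathbb{C}[x,y] \mid hP^N\in\langle f,g\rangle \text{ for some } N\}$ for generic $S$. *)

theory Defs
  imports
    Complex_Main
    "HOL-Computational_Algebra.Polynomial"
    "Jordan_Normal_Form.Determinant"
begin

section \<open>Zariski open sets\<close>

text \<open>The polynomial functions in a given family of coordinate functions on a space \<open>'v\<close>.\<close>

inductive_set polynomial_functions :: "('v \<Rightarrow> 'k::comm_ring_1) set \<Rightarrow> ('v \<Rightarrow> 'k) set"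
  for coords :: "('v \<Rightarrow> 'k) set" where
  coord: "x \<in> coords \<Longrightarrow> x \<in> polynomial_functions coords"
| const: "(\<lambda>_. c) \<in> polynomial_functions coords"
| add: "p \<in> polynomial_functions coords \<Longrightarrow> q \<in> polynomial_functions coords \<Longrightarrow>
    (\<lambda>v. p v + q v) \<in> polynomial_functions coords"
| mult: "p \<in> polynomial_functions coords \<Longrightarrow> q \<in> polynomial_functions coords \<Longrightarrow>
    (\<lambda>v. p v * q v) \<in> polynomial_functions coords"

definition zariski_open_in :: "'v set \<Rightarrow> ('v \<Rightarrow> 'k::comm_ring_1) set \<Rightarrow> 'v set \<Rightarrow> bool" where
  "zariski_open_in X coords U \<longleftrightarrow>
    (\<exists>F \<subseteq> polynomial_functions coords. U = X - {v \<in> X. \<forall>p\<in>F. p v = 0})"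

definition sym_mats :: "nat \<Rightarrow> 'a mat set" where
  "sym_mats n = {A \<in> carrier_mat n n. transpose_mat A = A}"

definition mat_coords :: "nat \<Rightarrow> ('a mat \<Rightarrow> 'a) set" where
  "mat_coords n = {(\<lambda>A. A $$ (i, j)) | i j. i < n \<and> j < n}"

definition mat_pair_coords :: "nat \<Rightarrow> ('a mat \<times> 'a mat \<Rightarrow> 'a) set" where
  "mat_pair_coords n = (\<lambda>x. x \<circ> fst) ` mat_coords n \<union> (\<lambda>x. x \<circ> snd) ` mat_coords n"


section \<open>The model\<close>

definition PD :: "nat \<Rightarrow> real mat set" where
  "PD n = {M \<in> sym_mats n. \<forall>v \<in> carrier_vec n. v \<noteq> 0\<^sub>v n \<longrightarrow> v \<bullet> (M *\<^sub>v v) > 0}"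

definition cov_model :: "nat \<Rightarrow> real mat \<Rightarrow> real mat \<Rightarrow> real mat set" where
  "cov_model n A B = {x \<cdot>\<^sub>m A + y \<cdot>\<^sub>m B | x y. True} \<inter> PD n"


section \<open>The score equations\<close>

text \<open>
  The ring \<open>\<complex>[x,y]\<close> is represented by \<^typ>\<open>complex poly poly\<close>: the outer variable is \<open>y\<close>, and the
  coefficients are polynomials in \<open>x\<close>.
\<close>

definition const2 :: "complex \<Rightarrow> complex poly poly" where
  "const2 c = [:[:c:]:]"

definition varx :: "complex poly poly" where
  "varx = [:[:0, 1:]:]"

definition vary :: "complex poly poly" where
  "vary = [:0, 1:]"

definition dx :: "complex poly poly \<Rightarrow> complex poly poly" where
  "dx p = map_poly pderiv p"

definition dy :: "complex poly poly \<Rightarrow> complex poly poly" where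
  "dy p = pderiv p"

definition mat_trace :: "'a::comm_monoid_add mat \<Rightarrow> 'a" where
  "mat_trace M = (\<Sum>i<dim_row M. M $$ (i, i))"

definition Sigma_poly :: "complex mat \<Rightarrow> complex mat \<Rightarrow> complex poly poly mat" where
  "Sigma_poly A B = varx \<cdot>\<^sub>m map_mat const2 A + vary \<cdot>\<^sub>m map_mat const2 B"

definition P_poly :: "complex mat \<Rightarrow> complex mat \<Rightarrow> complex poly poly" where
  "P_poly A B = det (Sigma_poly A B)"

definition T_poly :: "complex mat \<Rightarrow> complex mat \<Rightarrow> complex mat \<Rightarrow> complex poly poly" where
  "T_poly A B S = mat_trace (map_mat const2 S * adj_mat (Sigma_poly A B))"

text \<open>
  The numerators, over the denominator \<open>P\<^sup>2\<close>, of the partial derivatives of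
  \<open>log P + T / P\<close>.
\<close>

definition score_x :: "complex mat \<Rightarrow> complex mat \<Rightarrow> complex mat \<Rightarrow> complex poly poly" where
  "score_x A B S = (let P = P_poly A B; T = T_poly A B S in P * dx P + P * dx T - T * dx P)"

definition score_y :: "complex mat \<Rightarrow> complex mat \<Rightarrow> complex mat \<Rightarrow> complex poly poly" where
  "score_y A B S = (let P = P_poly A B; T = T_poly A B S in P * dy P + P * dy T - T * dy P)"


section \<open>Maximum likelihood degree\<close>

definition ideal2 :: "'a::comm_ring_1 \<Rightarrow> 'a \<Rightarrow> 'a set" where
  "ideal2 f g = {u * f + v * g | u v. True}"

definition saturation :: "'a::comm_ring_1 set \<Rightarrow> 'a \<Rightarrow> 'a set" where
  "saturation I p = {h. \<exists>N. h * p ^ N \<in> I}"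

text \<open>
  \<open>dim \<complex>[x,y]/J = d\<close> for an ideal \<open>J\<close>: the residue classes of some \<open>b 0, \<dots>, b (d - 1)\<close> span the
  quotient and are linearly independent in it. In particular the quotient is finite-dimensional.
\<close>

definition quotient_dim_eq :: "complex poly poly set \<Rightarrow> nat \<Rightarrow> bool" where
  "quotient_dim_eq J d \<longleftrightarrow> (\<exists>b :: nat \<Rightarrow> complex poly poly.
     (\<forall>h. \<exists>c. h - (\<Sum>i<d. const2 (c i) * b i) \<in> J) \<and>
     (\<forall>c. (\<Sum>i<d. const2 (c i) * b i) \<in> J \<longrightarrow> (\<forall>i<d. c i = 0)))"

definition score_ideal :: "complex mat \<Rightarrow> complex mat \<Rightarrow> complex mat \<Rightarrow> complex poly poly set" where
  "score_ideal A B S =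
    saturation (ideal2 (score_x A B S) (score_y A B S)) (P_poly A B)"

text \<open>
  The ML-degree of the model given by \<open>A\<close> and \<open>B\<close> is \<open>d\<close>: for all \<open>S\<close> in a nonempty Zariski open
  set, the saturated score ideal has degree \<open>d\<close>, that is, the score equations have \<open>d\<close> complex
  solutions with \<open>P \<noteq> 0\<close>, counted with multiplicity. As two nonempty Zariski open sets of symmetric
  matrices meet, at most one \<open>d\<close> has this property.
\<close>

definition has_ML_degree :: "nat \<Rightarrow> real mat \<Rightarrow> real mat \<Rightarrow> nat \<Rightarrow> bool" where
  "has_ML_degree n A B d \<longleftrightarrow>
    (\<exists>V. zariski_open_in (sym_mats n) (mat_coords n) V \<and> V \<noteq> {} \<and>
      (\<forall>S\<in>V. quotient_dim_eq
        (score_ideal (map_mat complex_of_real A) (map_mat complex_of_real B) S) d))"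

end

theory Submission
  imports Defs
    "HOL-Computational_Algebra.Fundamental_Theorem_Algebra"
    "HOL-Computational_Algebra.Field_as_Ring"
    "Subresultants.Subresultant_Gcd"
begin

text \<open>
  Let \<open>P = det \<Sigma>\<close> and \<open>T = tr (S adj \<Sigma>)\<close>. They are forms in \<open>x, y\<close> of degrees \<open>n\<close> and \<open>n - 1\<close>, and
  this alone gives the count. Let \<open>f, g\<close> be the numerators of the score equations. By Euler's identity
  \<open>x f + y g = P (n P - T)\<close>, so the saturation \<open>J\<close> contains \<open>n P - T\<close>. Subtracting multiples of this
  from \<open>f\<close> and \<open>g\<close> and cancelling \<open>P\<close> shows that \<open>J\<close> also contains \<open>T\<^sub>x - (n - 1) P\<^sub>x\<close> and
  \<open>T\<^sub>y - (n - 1) P\<^sub>y\<close>, and with them the Jacobian determinant \<open>W = T\<^sub>x P\<^sub>y - T\<^sub>y P\<^sub>x\<close>, a form of degree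
  \<open>(n - 2) + (n - 1) = 2 n - 3\<close>.

  A form vanishes along lines through the origin. Put \<open>p(s) = P(1, s)\<close>, \<open>q(s) = T(1, s)\<close> and
  \<open>w(s) = W(1, s)\<close>. On the line \<open>y = s x\<close> the equation \<open>n P = T\<close> reads \<open>n x p(s) = q(s)\<close> away from the
  origin, so in the generic case each root \<open>s\<close> of \<open>w\<close> carries exactly one solution, with
  \<open>x = q(s) / (n p(s))\<close>. This becomes a statement with multiplicities as follows. If \<open>w\<close> has degree exactly
  \<open>2 n - 3\<close> and no root in common with \<open>p\<close> or \<open>q\<close>, then \<open>t = q / (n p)\<close> makes sense and is invertible
  modulo \<open>w\<close>, and the substitution \<open>x := t, y := s t\<close> induces an isomorphism from \<open>\<complex>[x, y] / J\<close>
  onto \<open>\<complex>[s] / (w)\<close>. That \<open>J\<close> is the kernel modulo \<open>w\<close> is \<open>in_J_iff\<close>, and the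
  dimension is read off in \<open>quotient_dim_J\<close>.

  The conditions on \<open>p\<close>, \<open>q\<close> and \<open>w\<close> follow from the nonvanishing of a single expression \<open>genericity\<close>, a
  product of three leading coefficients and a resultant, which is a polynomial in the entries of
  \<open>A\<close>, \<open>B\<close> and \<open>S\<close>. The open set of pairs consists of the \<open>(A, B)\<close> for which this polynomial
  does not vanish identically in \<open>S\<close>; then the \<open>S\<close> at which it does not vanish form a nonempty open set.
  It remains to find one triple where it does not vanish. Diagonal matrices suffice: with \<open>A\<close>
  carrying the negatives of the \<open>n\<close>-th roots of unity and \<open>B = 1\<close>, one gets \<open>p = s\<^sup>n - 1\<close>, and by Lagrange
  interpolation diagonal \<open>S\<close> produce every \<open>q\<close> of degree below \<open>n\<close>, in particular
  one for which the conditions can be checked by hand (\<open>example_generic\<close>).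

  The proofs use \<open>k = n - 2\<close>, so that \<open>n = k + 2\<close> and \<open>2 n - 3 = 2 k + 1\<close>.
\<close>

section \<open>Binary forms\<close>

lemma const2_1: "const2 1 = 1"
  by (simp add: const2_def)

lemma const2_mult: "const2 (a * b) = const2 a * const2 b"
  by (simp add: const2_def)

lemma const2_power: "const2 (a ^ d) = const2 a ^ d"
  by (induction d) (simp_all add: const2_1 const2_mult)

lemma const2_of_nat: "const2 (of_nat m) = of_nat m"
  by (simp add: const2_def of_nat_poly)

text \<open>
  Any ring-theoretic property of bivariate polynomials need only be checked on constants and on the two
  variables; this is how \<open>cleared_exists\<close> below avoids splitting a polynomial into homogeneous parts.
\<close>

lemma bivariate_induct [case_names const varx vary add mult]:
  assumes const: "\<And>c. Q (const2 c)"
    and x: "Q varx" and y: "Q vary"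
    and add: "\<And>f g. Q f \<Longrightarrow> Q g \<Longrightarrow> Q (f + g)"
    and mult: "\<And>f g. Q f \<Longrightarrow> Q g \<Longrightarrow> Q (f * g)"
  shows "Q h"
proof (induction h)
  case 0
  show ?case using const[of 0] by (simp add: const2_def)
next
  case (pCons a h)
  have "Q [:a:]"
  proof (induction a)
    case 0
    show ?case using const[of 0] by (simp add: const2_def)
  next
    case (pCons c a)
    have "[:pCons c a:] = const2 c + varx * [:a:]"
      by (simp add: const2_def varx_def)
    then show ?case using add[OF const mult[OF x pCons(2)]] by metis
  qed
  moreover have "pCons a h = [:a:] + vary * h"
    by (simp add: vary_def)
  ultimately show ?case using add mult y pCons by metis
qed

definition homogeneous :: "nat \<Rightarrow> 'a::zero poly poly \<Rightarrow> bool" where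
  "homogeneous m h \<longleftrightarrow> (\<forall>i j. coeff (coeff h i) j \<noteq> 0 \<longrightarrow> i + j = m)"

lemma homogeneous_0 [simp]: "homogeneous m 0"
  by (simp add: homogeneous_def)

lemma homogeneous_const2 [simp]: "homogeneous 0 (const2 c)"
  by (auto simp: homogeneous_def const2_def coeff_pCons split: nat.splits)

lemma homogeneous_1 [simp]: "homogeneous 0 (1 :: 'a::comm_semiring_1 poly poly)"
  by (simp add: homogeneous_def coeff_1)

lemma homogeneous_varx: "homogeneous 1 varx"
  by (auto simp: homogeneous_def varx_def coeff_pCons split: nat.splits)

lemma homogeneous_vary: "homogeneous 1 vary"
  by (auto simp: homogeneous_def vary_def coeff_pCons split: nat.splits)

lemma homogeneous_add:
  fixes f g :: "'a::comm_monoid_add poly poly"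
  shows "homogeneous m f \<Longrightarrow> homogeneous m g \<Longrightarrow> homogeneous m (f + g)"
  by (force simp: homogeneous_def)

lemma homogeneous_of_nat [simp]: "homogeneous 0 (of_nat m :: 'a::comm_semiring_1 poly poly)"
  by (induction m) (auto intro: homogeneous_add)

lemma homogeneous_minus:
  fixes f :: "'a::ab_group_add poly poly"
  shows "homogeneous m f \<Longrightarrow> homogeneous m (- f)"
  by (force simp: homogeneous_def)

lemma homogeneous_diff:
  fixes f g :: "'a::ab_group_add poly poly"
  shows "homogeneous m f \<Longrightarrow> homogeneous m g \<Longrightarrow> homogeneous m (f - g)"
  by (force simp: homogeneous_def)

lemma homogeneous_sum:
  fixes f :: "'i \<Rightarrow> 'a::comm_monoid_add poly poly"
  assumes "\<And>i. i \<in> I \<Longrightarrow> homogeneous m (f i)"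
  shows "homogeneous m (\<Sum>i\<in>I. f i)"
  using assms by (induction I rule: infinite_finite_induct) (auto intro: homogeneous_add)

lemma homogeneous_mult:
  fixes f g :: "'a::comm_semiring_0 poly poly"
  assumes "homogeneous k f" "homogeneous m g"
  shows "homogeneous (k + m) (f * g)"
  unfolding homogeneous_def
proof (intro allI impI)
  fix i j
  assume "coeff (coeff (f * g) i) j \<noteq> 0"
  then have "(\<Sum>a\<le>i. \<Sum>b\<le>j. coeff (coeff f a) b * coeff (coeff g (i - a)) (j - b)) \<noteq> 0"
    by (simp add: coeff_mult coeff_sum)
  then obtain a where a: "a \<le> i"
    "(\<Sum>b\<le>j. coeff (coeff f a) b * coeff (coeff g (i - a)) (j - b)) \<noteq> 0"
    by (meson atMost_iff sum.not_neutral_contains_not_neutral)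
  then obtain b where b: "b \<le> j" "coeff (coeff f a) b * coeff (coeff g (i - a)) (j - b) \<noteq> 0"
    by (meson atMost_iff sum.not_neutral_contains_not_neutral)
  from b(2) have "coeff (coeff f a) b \<noteq> 0" "coeff (coeff g (i - a)) (j - b) \<noteq> 0"
    by auto
  then have "a + b = k" "(i - a) + (j - b) = m"
    using assms by (auto simp: homogeneous_def)
  then show "i + j = k + m" using a b by linarith
qed

lemma homogeneous_prod:
  fixes f :: "'i \<Rightarrow> 'a::comm_semiring_1 poly poly"
  assumes "\<And>i. i \<in> I \<Longrightarrow> homogeneous (k i) (f i)"
  shows "homogeneous (\<Sum>i\<in>I. k i) (\<Prod>i\<in>I. f i)"
  using assms
  by (induction I rule: infinite_finite_induct)
     (auto intro: homogeneous_mult)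

lemma homogeneous_power:
  fixes f :: "'a::comm_semiring_1 poly poly"
  shows "homogeneous k f \<Longrightarrow> homogeneous (d * k) (f ^ d)"
  by (induction d) (auto intro: homogeneous_mult)

lemma coeff_coeff_dx: "coeff (coeff (dx h) i) j = of_nat (Suc j) * coeff (coeff h i) (Suc j)"
  by (simp add: dx_def coeff_map_poly coeff_pderiv)

lemma coeff_coeff_dy: "coeff (coeff (dy h) i) j = of_nat (Suc i) * coeff (coeff h (Suc i)) j"
  by (simp add: dy_def coeff_pderiv flip: of_nat_Suc)
     (simp add: of_nat_poly)

lemma homogeneous_dx: "homogeneous (Suc m) h \<Longrightarrow> homogeneous m (dx h)"
  unfolding homogeneous_def coeff_coeff_dx by fastforce

lemma homogeneous_dy: "homogeneous (Suc m) h \<Longrightarrow> homogeneous m (dy h)"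
  unfolding homogeneous_def coeff_coeff_dy by fastforce

lemma coeff_coeff_varx_mult:
  "coeff (coeff (varx * h) i) j = (case j of 0 \<Rightarrow> 0 | Suc j' \<Rightarrow> coeff (coeff h i) j')"
  by (simp add: varx_def coeff_pCons split: nat.splits)

lemma coeff_coeff_vary_mult:
  "coeff (coeff (vary * h) i) j = (case i of 0 \<Rightarrow> 0 | Suc i' \<Rightarrow> coeff (coeff h i') j)"
  by (simp add: vary_def coeff_pCons split: nat.splits)

lemma euler_identity:
  assumes "homogeneous m h"
  shows "varx * dx h + vary * dy h = of_nat m * h"
proof (rule poly_eqI, rule poly_eqI)
  fix i j
  have "coeff (coeff (of_nat m * h) i) j = of_nat m * coeff (coeff h i) j"
    by (simp add: of_nat_poly)
  moreover have "coeff (coeff (varx * dx h + vary * dy h) i) j = of_nat (i + j) * coeff (coeff h i) j"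
    by (simp add: coeff_coeff_varx_mult coeff_coeff_vary_mult coeff_coeff_dx coeff_coeff_dy
        algebra_simps split: nat.splits)
  ultimately show "coeff (coeff (varx * dx h + vary * dy h) i) j = coeff (coeff (of_nat m * h) i) j"
    using assms unfolding homogeneous_def by (cases "coeff (coeff h i) j = 0") (simp, metis)
qed

text \<open>
  The substitution \<open>x := t, y := s t\<close>, where \<open>s\<close> is the variable of the resulting univariate polynomial.
  The point moves on the line of slope \<open>s\<close>, at the abscissa \<open>t(s)\<close>. The case \<open>t = 1\<close> is
  dehomogenization.
\<close>

definition on_lines :: "'a::comm_ring_1 poly \<Rightarrow> 'a poly poly \<Rightarrow> 'a poly" where
  "on_lines t h = poly (map_poly (\<lambda>q. q \<circ>\<^sub>p t) h) ([:0, 1:] * t)"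

lemma pcompose_hom: "comm_ring_hom (\<lambda>q. q \<circ>\<^sub>p t)"
  by unfold_locales (auto simp: pcompose_add pcompose_mult pcompose_1)

lemma on_lines_hom: "comm_ring_hom (on_lines t)"
proof -
  interpret pc: comm_ring_hom "\<lambda>q. q \<circ>\<^sub>p t" by (rule pcompose_hom)
  interpret mp: map_poly_comm_ring_hom "\<lambda>q. q \<circ>\<^sub>p t" ..
  show ?thesis
    by unfold_locales (auto simp: on_lines_def mp.hom_add mp.hom_mult)
qed

interpretation on_lines: comm_ring_hom "on_lines t" for t
  by (rule on_lines_hom)

lemma on_lines_coeff_poly: "on_lines t [:q:] = q \<circ>\<^sub>p t"
  by (cases "q = 0") (simp_all add: on_lines_def map_poly_pCons)

lemma on_lines_const2 [simp]: "on_lines t (const2 c) = [:c:]"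
  by (simp add: const2_def on_lines_coeff_poly)

lemma on_lines_varx [simp]: "on_lines t varx = t"
  by (simp add: on_lines_def varx_def pcompose_pCons)

lemma on_lines_vary [simp]: "on_lines t vary = [:0, 1:] * t"
  by (simp add: on_lines_def vary_def map_poly_pCons pcompose_1 del: mult_pCons_left)

lemma coeff_on_lines_1: "coeff (on_lines 1 h) i = poly (coeff h i) 1"
proof -
  have const: "q \<circ>\<^sub>p 1 = [:poly q 1:]" for q :: "'a poly"
    by (induction q) (simp_all add: pcompose_pCons)
  have "on_lines 1 h = map_poly (\<lambda>q. poly q 1) h"
    by (induction h) (simp_all add: on_lines_def const map_poly_pCons)
  then show ?thesis by (simp add: coeff_map_poly)
qed

text \<open>
  The power of \<open>y\<close> in a monomial of a form determines the power of \<open>x\<close>, so each coefficient with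
  respect to \<open>y\<close> is a monomial in \<open>x\<close>, and its constant is recovered by evaluating at \<open>x = 1\<close>.
\<close>

lemma homogeneous_coeff:
  fixes h :: "'a::comm_ring_1 poly poly"
  assumes "homogeneous m h"
  shows "coeff h i = monom (poly (coeff h i) 1) (m - i)"
proof -
  have eq: "coeff h i = monom (coeff (coeff h i) (m - i)) (m - i)"
  proof (rule poly_eqI)
    fix n
    have "coeff (coeff h i) n = 0 \<or> i + n = m"
      using assms by (auto simp: homogeneous_def)
    then show "coeff (coeff h i) n = coeff (monom (coeff (coeff h i) (m - i)) (m - i)) n"
      by (auto simp: coeff_monom)
  qed
  have "poly (coeff h i) 1 = coeff (coeff h i) (m - i)"
    by (subst eq) (simp add: poly_monom)
  then show ?thesis using eq by simp
qed

lemma pcompose_monom: "monom c k \<circ>\<^sub>p u = [:c:] * u ^ k"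
  by (induction k) (simp_all add: monom_0 monom_Suc pcompose_pCons ac_simps)

lemma on_lines_homogeneous:
  assumes "homogeneous m h"
  shows "on_lines t h = t ^ m * on_lines 1 h"
proof -
  note coeff = homogeneous_coeff[OF assms]
  have le: "i \<le> m" if "coeff h i \<noteq> 0" for i
  proof -
    from that obtain j where "coeff (coeff h i) j \<noteq> 0"
      by (auto simp: poly_eq_iff)
    with assms have "i + j = m" by (simp add: homogeneous_def)
    then show ?thesis by simp
  qed
  have line: "on_lines u h =
      (\<Sum>i\<le>degree h. [:poly (coeff h i) 1:] * (u ^ (m - i) * ([:0, 1:] * u) ^ i))" for u
  proof -
    have vanish: "coeff h i \<circ>\<^sub>p u = 0" if "degree (map_poly (\<lambda>q. q \<circ>\<^sub>p u) h) < i" for i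
      using coeff_eq_0[OF that] by (simp add: coeff_map_poly)
    have "on_lines u h = (\<Sum>i\<le>degree (map_poly (\<lambda>q. q \<circ>\<^sub>p u) h). (coeff h i \<circ>\<^sub>p u) * ([:0, 1:] * u) ^ i)"
      by (simp add: on_lines_def poly_altdef coeff_map_poly)
    also have "\<dots> = (\<Sum>i\<le>degree h. (coeff h i \<circ>\<^sub>p u) * ([:0, 1:] * u) ^ i)"
      by (rule sum.mono_neutral_left)
         (use vanish in \<open>auto simp: degree_map_poly_le not_le simp del: mult_pCons_left\<close>)
    also have "\<dots> = (\<Sum>i\<le>degree h. [:poly (coeff h i) 1:] * (u ^ (m - i) * ([:0, 1:] * u) ^ i))"
      by (rule sum.cong, simp, subst coeff) (simp add: pcompose_monom mult.assoc)
    finally show ?thesis .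
  qed
  have "[:poly (coeff h i) 1:] * (t ^ (m - i) * ([:0, 1:] * t) ^ i) =
      t ^ m * ([:poly (coeff h i) 1:] * (1 ^ (m - i) * ([:0, 1:] * 1) ^ i))" for i
  proof (cases "coeff h i = 0")
    case False
    then have "t ^ m = t ^ (m - i) * t ^ i"
      by (simp add: le flip: power_add)
    then show ?thesis by (simp only: power_mult_distrib power_one mult_1_right mult_1 ac_simps)
  qed simp
  then show ?thesis
    unfolding line sum_distrib_left by (intro sum.cong) auto
qed

lemma homogeneous_eqI:
  assumes "homogeneous m g" "homogeneous m h" "on_lines 1 g = on_lines 1 h"
  shows "g = h"
proof (rule poly_eqI)
  fix i
  have "coeff f i = monom (coeff (on_lines 1 f) i) (m - i)" if "homogeneous m f"
    for f :: "'a poly poly"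
    unfolding coeff_on_lines_1 by (rule homogeneous_coeff[OF that])
  from this[OF assms(1)] this[OF assms(2)] show "coeff g i = coeff h i"
    using assms(3) by simp
qed

lemma degree_on_lines_1_le:
  assumes "homogeneous m h"
  shows "degree (on_lines 1 h) \<le> m"
proof (rule degree_le, intro allI impI)
  fix i assume "m < i"
  then have "coeff h i = 0"
    using assms by (intro poly_eqI) (auto simp: homogeneous_def)
  then show "coeff (on_lines 1 h) i = 0" by (simp add: coeff_on_lines_1)
qed

lemma homogenization_exists:
  fixes q :: "'a::comm_ring_1 poly"
  assumes "degree q \<le> m"
  obtains h where "homogeneous m h" "on_lines 1 h = q"
proof
  let ?h = "\<Sum>i\<le>m. monom (monom (coeff q i) (m - i)) i"
  show "homogeneous m ?h"
    by (intro homogeneous_sum) (auto simp: homogeneous_def coeff_monom)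
  show "on_lines 1 ?h = q"
  proof (rule poly_eqI)
    fix i
    have "coeff ?h i = (\<Sum>j\<le>m. if j = i then monom (coeff q j) (m - j) else 0)"
      by (simp only: coeff_sum coeff_monom)
    also have "\<dots> = (if i \<le> m then monom (coeff q i) (m - i) else 0)"
      by simp
    finally show "coeff (on_lines 1 ?h) i = coeff q i"
      using assms by (auto simp: coeff_on_lines_1 poly_monom coeff_eq_0)
  qed
qed

lemma on_lines_1_dy: "on_lines 1 (dy h) = pderiv (on_lines 1 h)"
proof (rule poly_eqI)
  fix i
  have "coeff (dy h) i = of_nat (Suc i) * coeff h (Suc i)"
    by (simp only: dy_def coeff_pderiv)
  then have "poly (coeff (dy h) i) 1 = of_nat (Suc i) * poly (coeff h (Suc i)) 1"
    by (simp only: poly_mult poly_of_nat)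
  then show "coeff (on_lines 1 (dy h)) i = coeff (pderiv (on_lines 1 h)) i"
    by (simp only: coeff_on_lines_1 coeff_pderiv)
qed

text \<open>
  Only \<open>\<partial>/\<partial>y\<close> commutes with setting \<open>x = 1\<close>; the other partial derivative is obtained from Euler's
  identity.
\<close>

lemma on_lines_1_dx:
  assumes "homogeneous m h"
  shows "on_lines 1 (dx h) = of_nat m * on_lines 1 h - [:0, 1:] * pderiv (on_lines 1 h)"
  using arg_cong[OF euler_identity[OF assms], of "on_lines 1"]
  by (simp add: on_lines.hom_add on_lines.hom_mult on_lines.hom_of_nat on_lines_1_dy eq_diff_eq
      del: mult_pCons_left)

section \<open>Saturated ideals\<close>

lemma ideal2_add: "a \<in> ideal2 f g \<Longrightarrow> b \<in> ideal2 f g \<Longrightarrow> a + b \<in> ideal2 f g"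
  unfolding ideal2_def
proof clarify
  fix u v u' v'
  have "u * f + v * g + (u' * f + v' * g) = (u + u') * f + (v + v') * g"
    by (simp add: algebra_simps)
  then show "\<exists>ua va. u * f + v * g + (u' * f + v' * g) = ua * f + va * g \<and> True"
    by blast
qed

lemma ideal2_mult: "a \<in> ideal2 f g \<Longrightarrow> r * a \<in> ideal2 f g"
  unfolding ideal2_def
proof clarify
  fix u v
  have "r * (u * f + v * g) = (r * u) * f + (r * v) * g"
    by (simp add: algebra_simps)
  then show "\<exists>ua va. r * (u * f + v * g) = ua * f + va * g \<and> True"
    by blast
qed

lemma saturation_add:
  assumes "a \<in> saturation (ideal2 f g) p" "b \<in> saturation (ideal2 f g) p"
  shows "a + b \<in> saturation (ideal2 f g) p"
proof -
  from assms obtain M N where "a * p ^ M \<in> ideal2 f g" "b * p ^ N \<in> ideal2 f g"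
    by (auto simp: saturation_def)
  then have "p ^ N * (a * p ^ M) + p ^ M * (b * p ^ N) \<in> ideal2 f g"
    using ideal2_add ideal2_mult by metis
  also have "p ^ N * (a * p ^ M) + p ^ M * (b * p ^ N) = (a + b) * p ^ (M + N)"
    by (simp add: power_add algebra_simps)
  finally show ?thesis by (auto simp: saturation_def)
qed

lemma saturation_mult:
  assumes "a \<in> saturation (ideal2 f g) p"
  shows "r * a \<in> saturation (ideal2 f g) p"
proof -
  from assms obtain N where "a * p ^ N \<in> ideal2 f g"
    by (auto simp: saturation_def)
  from ideal2_mult[OF this, of r] show ?thesis
    by (auto simp: saturation_def mult.assoc)
qed

lemma saturation_diff:
  assumes "a \<in> saturation (ideal2 f g) p" "b \<in> saturation (ideal2 f g) p"
  shows "a - b \<in> saturation (ideal2 f g) p"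
  using saturation_add[OF assms(1) saturation_mult[OF assms(2), of "- 1"]] by simp

lemma saturation_cancel:
  assumes "p ^ M * a \<in> saturation (ideal2 f g) p"
  shows "a \<in> saturation (ideal2 f g) p"
proof -
  from assms obtain N where "p ^ M * a * p ^ N \<in> ideal2 f g"
    by (auto simp: saturation_def)
  moreover have "p ^ M * a * p ^ N = a * p ^ (M + N)"
    by (simp add: power_add algebra_simps)
  ultimately have "a * p ^ (M + N) \<in> ideal2 f g"
    by simp
  then show ?thesis unfolding saturation_def by blast
qed

lemma ideal2_subset_saturation: "a \<in> ideal2 f g \<Longrightarrow> a \<in> saturation (ideal2 f g) p"
  unfolding saturation_def by (intro CollectI exI[of _ 0]) simp

lemma generators_in_ideal2: "f \<in> ideal2 f g" "g \<in> ideal2 f g"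
proof -
  have "f = 1 * f + 0 * g" "g = 0 * f + 1 * g" by simp_all
  then show "f \<in> ideal2 f g" "g \<in> ideal2 f g"
    unfolding ideal2_def by blast+
qed

section \<open>Inverses modulo a univariate polynomial\<close>

text \<open>
  The inverse can be taken to be a polynomial in \<open>a\<close> itself. This stronger form is what surjectivity of the
  substitution needs: \<open>1/x\<close> is then congruent to a polynomial in \<open>x\<close>, and \<open>y/x\<close> is hit. The roots
  of \<open>w\<close> are treated one at a time: modulo \<open>s - r\<close> the inverse is the constant \<open>1/a(r)\<close>, and two partial
  inverses \<open>c\<close> and \<open>c'\<close> combine through \<open>(a c - 1) (a c' - 1) = 1 - a (c + c' - a c c')\<close>.
\<close>

lemma inverse_modulo:
  fixes w a :: "complex poly"
  assumes "w \<noteq> 0" "\<And>r. poly w r = 0 \<Longrightarrow> poly a r \<noteq> 0"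
  obtains q where "w dvd a * (q \<circ>\<^sub>p a) - 1"
proof -
  have "\<exists>q. w dvd a * (q \<circ>\<^sub>p a) - 1"
    using assms
  proof (induction "degree w" arbitrary: w)
    case 0
    then have "w dvd 1" by (simp add: is_unit_iff_degree)
    then show ?case by (meson dvd_trans one_dvd)
  next
    case (Suc m)
    then have "\<not> constant (poly w)" by (simp add: constant_degree)
    then obtain r where r: "poly w r = 0"
      using fundamental_theorem_of_algebra by blast
    then obtain w' where w: "w = [:- r, 1:] * w'"
      by (metis dvdE poly_eq_0_iff_dvd)
    then have w'0: "w' \<noteq> 0" using Suc by auto
    then have "degree w = Suc (degree w')" unfolding w by (subst degree_mult_eq) auto
    then have "m = degree w'" using Suc by simp
    then obtain q where q: "w' dvd a * (q \<circ>\<^sub>p a) - 1"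
      using Suc w w'0 by fastforce
    define q' where "q' = [:inverse (poly a r):]"
    have "poly (a * (q' \<circ>\<^sub>p a) - 1) r = 0"
      using Suc(4)[OF r] by (simp add: q'_def pcompose_const)
    then have q': "[:- r, 1:] dvd a * (q' \<circ>\<^sub>p a) - 1"
      by (simp only: poly_eq_0_iff_dvd)
    have X: "[:0, 1:] \<circ>\<^sub>p a = a" by (simp add: pcompose_pCons)
    have "a * ((q + q' - [:0, 1:] * q * q') \<circ>\<^sub>p a) - 1 =
        - ((a * (q' \<circ>\<^sub>p a) - 1) * (a * (q \<circ>\<^sub>p a) - 1))"
      unfolding pcompose_add pcompose_diff pcompose_mult X by (simp add: algebra_simps)
    then have "w dvd a * ((q + q' - [:0, 1:] * q * q') \<circ>\<^sub>p a) - 1"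
      using mult_dvd_mono[OF q' q] unfolding w by simp
    then show ?case by blast
  qed
  then show ?thesis using that by blast
qed

lemma dvd_cancel_modulo:
  fixes w a b :: "complex poly"
  assumes "w \<noteq> 0" "\<And>r. poly w r = 0 \<Longrightarrow> poly b r \<noteq> 0" "w dvd a * b"
  shows "w dvd a"
proof -
  obtain q where q: "w dvd b * (q \<circ>\<^sub>p b) - 1"
    using inverse_modulo[OF assms(1,2)] .
  have "w dvd (a * b) * (q \<circ>\<^sub>p b) - a * (b * (q \<circ>\<^sub>p b) - 1)"
    by (rule dvd_diff[OF dvd_mult2[OF assms(3)] dvd_mult[OF q]])
  then show ?thesis by (simp add: algebra_simps)
qed

section \<open>The quotient by the saturated score ideal\<close>

text \<open>
  The Jacobian determinant \<open>T\<^sub>x P\<^sub>y - T\<^sub>y P\<^sub>x\<close> at \<open>(1, s)\<close>, for forms of degrees \<open>n\<close> and \<open>n - 1\<close> with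
  dehomogenizations \<open>p\<close> and \<open>q\<close>. The terms of degree \<open>2 n - 2\<close> cancel.
\<close>

definition critical_poly :: "nat \<Rightarrow> 'a::idom poly \<Rightarrow> 'a poly \<Rightarrow> 'a poly" where
  "critical_poly n p q = of_nat (n - 1) * q * pderiv p - of_nat n * p * pderiv q"

text \<open>
  The score polynomials under the substitution, multiplied by \<open>n\<close>. Here \<open>X\<close> stands for \<open>s\<close>, \<open>u\<close> for
  \<open>t^(n - 2)\<close>, \<open>N\<close> and \<open>M\<close> for \<open>n\<close> and \<open>n - 1\<close>, and primes for derivatives. The right-hand sides
  exhibit them in the ideal generated by \<open>N p t - q\<close> and the Jacobian, both of which are multiples of \<open>w\<close>.
\<close>

lemma score_x_identity:
  fixes X M N u t p q p' q' :: "'a::comm_ring_1"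
  assumes N: "N = M + 1"
  shows "N * (t * (t * u) * p * (t * u * (N * p - X * p')) + t * (t * u) * p * (u * (M * q - X * q'))
      - t * u * q * (t * u * (N * p - X * p'))) =
    t * t * u * u * ((N * p * t - q) * (N * p - X * p') + X * (M * q * p' - N * p * q'))"
  unfolding N by (simp add: algebra_simps)

lemma score_y_identity:
  fixes M N u t p q p' q' :: "'a::comm_ring_1"
  assumes N: "N = M + 1"
  shows "N * (t * (t * u) * p * (t * u * p') + t * (t * u) * p * (u * q')
      - t * u * q * (t * u * p')) =
    t * t * u * u * ((N * p * t - q) * p' - (M * q * p' - N * p * q'))"
  unfolding N by (simp add: algebra_simps)

text \<open>
  The rules for adding and multiplying congruences \<open>a f \<equiv> F\<close> and \<open>b g \<equiv> G\<close>, used in \<open>J\<close> and modulo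
  \<open>w\<close>.
\<close>

lemma clearing_denominators:
  fixes a b f g F G :: "'a::comm_ring_1"
  shows clear_sum: "b * (a * f - F) + a * (b * g - G) = (a * b) * (f + g) - (b * F + a * G)"
    and clear_sum': "b * (F - a * f) + a * (G - b * g) = (b * F + a * G) - (a * b) * (f + g)"
    and clear_product: "b * g * (a * f - F) + F * (b * g - G) = (a * b) * (f * g) - F * G"
    and clear_product': "G * (F - a * f) + a * f * (G - b * g) = F * G - (a * b) * (f * g)"
  by (simp_all add: algebra_simps)

locale score_forms =
  fixes k :: nat and P T :: "complex poly poly"
  assumes P: "homogeneous (Suc (Suc k)) P" and T: "homogeneous (Suc k) T"
begin

abbreviation "N \<equiv> of_nat (Suc (Suc k))"
abbreviation "M \<equiv> of_nat (Suc k)"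

definition "p = on_lines 1 P"
definition "q = on_lines 1 T"
definition "w = critical_poly (Suc (Suc k)) p q"

definition "fx = P * dx P + P * dx T - T * dx P"
definition "fy = P * dy P + P * dy T - T * dy P"
definition "J = saturation (ideal2 fx fy) P"

definition "W = dx T * dy P - dy T * dx P"

lemma w_eq: "w = M * q * pderiv p - N * p * pderiv q"
  by (simp add: w_def critical_poly_def)

lemma fx_in_J: "fx \<in> J" and fy_in_J: "fy \<in> J"
  unfolding J_def by (intro ideal2_subset_saturation generators_in_ideal2)+

lemmas J_closed = saturation_add[of _ fx fy P, folded J_def]
  saturation_diff[of _ fx fy P, folded J_def] saturation_mult[of _ fx fy P, folded J_def]

lemma J_cancel: "P ^ m * a \<in> J \<Longrightarrow> a \<in> J"
  unfolding J_def by (rule saturation_cancel)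

lemma NP_minus_T_in_J: "N * P - T \<in> J"
proof -
  have N: "(N :: complex poly poly) = M + 1" by simp
  have eP: "varx * dx P + vary * dy P = N * P" by (rule euler_identity[OF P])
  have eT: "varx * dx T + vary * dy T = M * T" by (rule euler_identity[OF T])
  \<comment> \<open>Only the difference \<open>n - (n - 1) = 1\<close> of the two degrees survives in the coefficient of \<open>P T\<close>.\<close>
  have "varx * fx + vary * fy = P * (varx * dx P + vary * dy P) + P * (varx * dx T + vary * dy T)
      - T * (varx * dx P + vary * dy P)"
    unfolding fx_def fy_def by (simp only: algebra_simps)
  also have "\<dots> = P * (N * P - T)"
    unfolding eP eT N by (simp only: algebra_simps mult_1)
  finally have "P ^ 1 * (N * P - T) = varx * fx + vary * fy" by simp
  then have "P ^ 1 * (N * P - T) \<in> J"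
    by (simp only: J_closed fx_in_J fy_in_J)
  then show ?thesis by (rule J_cancel)
qed

text \<open>
  These are the partial derivatives of \<open>T - (n - 1) P\<close>: outside \<open>P = 0\<close> the score equations describe the
  critical points of this difference.
\<close>

lemma gradient_in_J: "dx T - M * dx P \<in> J" "dy T - M * dy P \<in> J"
proof -
  have N: "(N :: complex poly poly) = M + 1" by simp
  have "P ^ 1 * (dx T - M * dx P) = fx - dx P * (N * P - T)"
    unfolding fx_def N by (simp only: algebra_simps mult_1 power_one_right)
  then have "P ^ 1 * (dx T - M * dx P) \<in> J"
    by (simp only: J_closed fx_in_J NP_minus_T_in_J)
  then show "dx T - M * dx P \<in> J" by (rule J_cancel)
  have "P ^ 1 * (dy T - M * dy P) = fy - dy P * (N * P - T)"
    unfolding fy_def N by (simp only: algebra_simps mult_1 power_one_right)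
  then have "P ^ 1 * (dy T - M * dy P) \<in> J"
    by (simp only: J_closed fy_in_J NP_minus_T_in_J)
  then show "dy T - M * dy P \<in> J" by (rule J_cancel)
qed

lemma W_in_J: "W \<in> J"
proof -
  have "W = dy P * (dx T - M * dx P) - dx P * (dy T - M * dy P)"
    unfolding W_def by (simp only: algebra_simps)
  then show ?thesis by (simp only: J_closed gradient_in_J)
qed

lemma homogeneous_W: "homogeneous (2 * k + 1) W"
proof -
  have "homogeneous (k + Suc k) (dx T * dy P)" "homogeneous (k + Suc k) (dy T * dx P)"
    by (intro homogeneous_mult homogeneous_dx homogeneous_dy P T)+
  then show ?thesis unfolding W_def by (simp add: homogeneous_diff mult_2)
qed

lemma on_lines_W: "on_lines 1 W = w"
  unfolding W_def w_eq on_lines.hom_minus on_lines.hom_mult on_lines_1_dy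
    on_lines_1_dx[OF P] on_lines_1_dx[OF T] p_def[symmetric] q_def[symmetric]
  by (simp only: algebra_simps)

end

text \<open>
  The leading coefficient condition keeps all solutions off the line \<open>x = 0\<close>. At a common root of \<open>w\<close> and
  \<open>p\<close> the abscissa \<open>q / (n p)\<close> would have a zero denominator; at one of \<open>w\<close> and \<open>q\<close> it would be zero
  and the point would be the origin, where \<open>P\<close> vanishes.
\<close>

locale generic_score_forms = score_forms +
  assumes deg_w: "coeff w (2 * k + 1) \<noteq> 0"
    and no_common_root: "\<And>r. poly w r = 0 \<Longrightarrow> poly p r \<noteq> 0 \<and> poly q r \<noteq> 0"
begin

lemma degree_w: "degree w = 2 * k + 1"
  using degree_on_lines_1_le[OF homogeneous_W] le_degree[OF deg_w] by (simp add: on_lines_W)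

lemma w_nonzero: "w \<noteq> 0"
  using deg_w by auto

text \<open>
  A polynomial representing \<open>q / (n p)\<close> modulo \<open>w\<close>; the inverse of \<open>n p\<close> that is chosen exists by
  \<open>inverse_modulo\<close>.
\<close>

definition t where "t = q * (SOME c. w dvd N * p * c - 1)"

lemma w_dvd_t: "w dvd N * p * t - q"
proof -
  have "poly (N * p) r \<noteq> 0" if "poly w r = 0" for r
    using no_common_root[OF that] by (simp del: of_nat_Suc)
  then obtain c where "w dvd N * p * (c \<circ>\<^sub>p (N * p)) - 1"
    using inverse_modulo[OF w_nonzero] by blast
  then have "w dvd N * p * (SOME c. w dvd N * p * c - 1) - 1"
    by (rule someI[of "\<lambda>c. w dvd N * p * c - 1"])
  then have "w dvd q * (N * p * (SOME c. w dvd N * p * c - 1) - 1)"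
    by (rule dvd_mult)
  then show ?thesis unfolding t_def by (simp only: algebra_simps mult_1)
qed

lemma t_nonzero:
  assumes "poly w r = 0"
  shows "poly t r \<noteq> 0"
proof
  assume "poly t r = 0"
  moreover have "poly (N * p * t - q) r = 0"
    using w_dvd_t assms by (metis dvdE mult_zero_left poly_mult)
  ultimately have "poly q r = 0" by simp
  then show False using no_common_root[OF assms] by simp
qed

abbreviation "sub \<equiv> on_lines t"

lemma sub_P: "sub P = t ^ Suc (Suc k) * p"
  unfolding p_def by (rule on_lines_homogeneous[OF P])

lemma sub_T: "sub T = t ^ Suc k * q"
  unfolding q_def by (rule on_lines_homogeneous[OF T])

lemma sub_derivatives:
  "sub (dx P) = t ^ Suc k * (N * p - [:0, 1:] * pderiv p)"
  "sub (dy P) = t ^ Suc k * pderiv p"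
  "sub (dx T) = t ^ k * (M * q - [:0, 1:] * pderiv q)"
  "sub (dy T) = t ^ k * pderiv q"
  unfolding p_def q_def
  by (subst on_lines_1_dx[OF P, symmetric], rule on_lines_homogeneous[OF homogeneous_dx[OF P]])
     (subst on_lines_1_dy[symmetric], rule on_lines_homogeneous[OF homogeneous_dy[OF P]],
      subst on_lines_1_dx[OF T, symmetric], rule on_lines_homogeneous[OF homogeneous_dx[OF T]],
      subst on_lines_1_dy[symmetric], rule on_lines_homogeneous[OF homogeneous_dy[OF T]])

lemma w_dvd_sub_score: "w dvd sub fx" "w dvd sub fy"
proof -
  have N: "(N :: complex poly) = M + 1" by simp
  have unit: "w dvd a" if "w dvd N * a" for a
  proof -
    have "N * a = smult (of_nat (Suc (Suc k))) a" by (simp add: of_nat_poly del: of_nat_Suc)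
    with that show ?thesis by (metis dvd_smult_cancel of_nat_eq_0_iff nat.distinct(1))
  qed
  define e where "e = N * p * t - q"
  have e: "w dvd e" unfolding e_def by (rule w_dvd_t)
  have fx: "N * sub fx = t * t * t ^ k * t ^ k * (e * (N * p - [:0, 1:] * pderiv p) + [:0, 1:] * w)"
    unfolding fx_def on_lines.hom_minus on_lines.hom_add on_lines.hom_mult sub_P sub_T sub_derivatives
      e_def w_eq power_Suc
    by (rule score_x_identity[OF N])
  from e have "w dvd N * sub fx" unfolding fx by (intro dvd_mult dvd_add dvd_mult2) auto
  then show "w dvd sub fx" by (rule unit)
  have fy: "N * sub fy = t * t * t ^ k * t ^ k * (e * pderiv p - w)"
    unfolding fy_def on_lines.hom_minus on_lines.hom_add on_lines.hom_mult sub_P sub_T sub_derivatives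
      e_def w_eq power_Suc
    by (rule score_y_identity[OF N])
  from e have "w dvd N * sub fy" unfolding fy by (intro dvd_mult dvd_diff dvd_mult2) auto
  then show "w dvd sub fy" by (rule unit)
qed

text \<open>
  Multiplication by a power of \<open>P\<close> in the saturation is harmless because \<open>P\<close> is sent to
  \<open>t\<^sup>n p\<close>, which is invertible modulo \<open>w\<close>.
\<close>

lemma w_dvd_sub_if_in_J:
  assumes "h \<in> J"
  shows "w dvd sub h"
proof -
  from assms obtain m u v where "h * P ^ m = u * fx + v * fy"
    by (auto simp: J_def saturation_def ideal2_def)
  then have "sub h * sub P ^ m = sub u * sub fx + sub v * sub fy"
    by (metis on_lines.hom_add on_lines.hom_mult on_lines.hom_power)
  then have "w dvd sub h * sub P ^ m"
    using w_dvd_sub_score by simp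
  moreover have "poly (sub P ^ m) r \<noteq> 0" if "poly w r = 0" for r
    using t_nonzero[OF that] no_common_root[OF that] by (simp add: sub_P)
  ultimately show ?thesis using dvd_cancel_modulo[OF w_nonzero] by blast
qed

text \<open>
  \<open>G\<close> is a homogeneous version of \<open>(n P)\<^sup>d h\<close>: as \<open>T \<equiv> n P\<close> modulo \<open>J\<close>, a component of \<open>h\<close> of
  degree \<open>e\<close> may be multiplied by \<open>T\<^sup>e (n P)\<^sup>d\<^sup>-\<^sup>e\<close> instead, and all these products have degree
  \<open>d n\<close>. On the other side, dehomogenizing \<open>G\<close> is the same as clearing the denominator \<open>n p\<close> in
  \<open>h(q / (n p), s q / (n p))\<close>.
\<close>

definition cleared :: "nat \<Rightarrow> complex poly poly \<Rightarrow> complex poly poly \<Rightarrow> bool" where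
  "cleared d h G \<longleftrightarrow> homogeneous (d * Suc (Suc k)) G \<and> (N * P) ^ d * h - G \<in> J \<and>
    w dvd on_lines 1 G - (N * p) ^ d * sub h"

lemma cleared_add:
  assumes F: "cleared d f F" and G: "cleared d' g G"
  shows "cleared (d + d') (f + g) ((N * P) ^ d' * F + (N * P) ^ d * G)"
  unfolding cleared_def
proof (intro conjI)
  have NP: "homogeneous (m * Suc (Suc k)) ((N * P) ^ m)" for m
    using homogeneous_power[OF homogeneous_mult[OF homogeneous_of_nat P]] by (simp only: add_0_left)
  have F1: "homogeneous (d * Suc (Suc k)) F" and G1: "homogeneous (d' * Suc (Suc k)) G"
    using F G by (simp_all add: cleared_def)
  have "homogeneous ((d + d') * Suc (Suc k)) ((N * P) ^ d' * F)"
    using homogeneous_mult[OF NP[of d'] F1] by (simp only: add_mult_distrib add.commute)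
  moreover have "homogeneous ((d + d') * Suc (Suc k)) ((N * P) ^ d * G)"
    using homogeneous_mult[OF NP[of d] G1] by (simp only: add_mult_distrib)
  ultimately show "homogeneous ((d + d') * Suc (Suc k)) ((N * P) ^ d' * F + (N * P) ^ d * G)"
    by (rule homogeneous_add)
  have "(N * P) ^ d' * ((N * P) ^ d * f - F) + (N * P) ^ d * ((N * P) ^ d' * g - G) \<in> J"
    using F G by (intro J_closed(1) J_closed(3)) (simp_all only: cleared_def)
  also have "(N * P) ^ d' * ((N * P) ^ d * f - F) + (N * P) ^ d * ((N * P) ^ d' * g - G) =
      (N * P) ^ (d + d') * (f + g) - ((N * P) ^ d' * F + (N * P) ^ d * G)"
    unfolding power_add by (rule clear_sum)
  finally show "(N * P) ^ (d + d') * (f + g) - ((N * P) ^ d' * F + (N * P) ^ d * G) \<in> J" .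
  have "w dvd (N * p) ^ d' * (on_lines 1 F - (N * p) ^ d * sub f) +
      (N * p) ^ d * (on_lines 1 G - (N * p) ^ d' * sub g)"
    using F G by (intro dvd_add dvd_mult) (simp_all only: cleared_def)
  also have "\<dots> = ((N * p) ^ d' * on_lines 1 F + (N * p) ^ d * on_lines 1 G) -
      (N * p) ^ (d + d') * (sub f + sub g)"
    unfolding power_add by (rule clear_sum')
  finally show "w dvd on_lines 1 ((N * P) ^ d' * F + (N * P) ^ d * G) - (N * p) ^ (d + d') * sub (f + g)"
    by (simp only: on_lines.hom_add on_lines.hom_mult on_lines.hom_power on_lines.hom_of_nat p_def)
qed

lemma cleared_mult:
  assumes F: "cleared d f F" and G: "cleared d' g G"
  shows "cleared (d + d') (f * g) (F * G)"
  unfolding cleared_def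
proof (intro conjI)
  have "homogeneous (d * Suc (Suc k)) F" "homogeneous (d' * Suc (Suc k)) G"
    using F G by (simp_all add: cleared_def)
  from homogeneous_mult[OF this] show "homogeneous ((d + d') * Suc (Suc k)) (F * G)"
    by (simp only: add_mult_distrib)
  have "((N * P) ^ d' * g) * ((N * P) ^ d * f - F) + F * ((N * P) ^ d' * g - G) \<in> J"
    using F G by (intro J_closed(1) J_closed(3)) (simp_all only: cleared_def)
  also have "((N * P) ^ d' * g) * ((N * P) ^ d * f - F) + F * ((N * P) ^ d' * g - G) =
      (N * P) ^ (d + d') * (f * g) - F * G"
    unfolding power_add by (rule clear_product)
  finally show "(N * P) ^ (d + d') * (f * g) - F * G \<in> J" .
  have "w dvd on_lines 1 G * (on_lines 1 F - (N * p) ^ d * sub f) +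
      (N * p) ^ d * sub f * (on_lines 1 G - (N * p) ^ d' * sub g)"
    using F G by (intro dvd_add dvd_mult) (simp_all only: cleared_def)
  also have "\<dots> = on_lines 1 F * on_lines 1 G - (N * p) ^ (d + d') * (sub f * sub g)"
    unfolding power_add by (rule clear_product')
  finally show "w dvd on_lines 1 (F * G) - (N * p) ^ (d + d') * sub (f * g)"
    by (simp only: on_lines.hom_mult)
qed

lemma cleared_linear:
  assumes l: "homogeneous 1 l"
  shows "cleared 1 l (T * l)"
  unfolding cleared_def
proof (intro conjI)
  show "homogeneous (1 * Suc (Suc k)) (T * l)"
    using homogeneous_mult[OF T l] by simp
  have "l * (N * P - T) \<in> J" by (intro J_closed NP_minus_T_in_J)
  also have "l * (N * P - T) = (N * P) ^ 1 * l - T * l"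
    by (simp only: power_one_right right_diff_distrib mult.commute)
  finally show "(N * P) ^ 1 * l - T * l \<in> J" .
  have "w dvd - on_lines 1 l * (N * p * t - q)"
    by (intro dvd_mult w_dvd_t)
  also have "- on_lines 1 l * (N * p * t - q) = q * on_lines 1 l - (N * p) ^ 1 * (t ^ 1 * on_lines 1 l)"
    unfolding power_one_right by (simp add: algebra_simps)
  finally show "w dvd on_lines 1 (T * l) - (N * p) ^ 1 * sub l"
    by (simp only: on_lines.hom_mult q_def on_lines_homogeneous[OF l, of t])
qed

lemma cleared_exists: "\<exists>d G. cleared d h G"
proof (induction h rule: bivariate_induct)
  case (const c)
  have "0 * W \<in> J" by (rule J_closed[OF W_in_J])
  then have "cleared 0 (const2 c) (const2 c)"
    by (simp add: cleared_def)
  then show ?case by blast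
qed (blast intro: cleared_linear homogeneous_varx homogeneous_vary cleared_add cleared_mult)+

text \<open>
  If \<open>w\<close> divides the substitution, it divides the dehomogenization of the form \<open>G\<close> attached to \<open>h\<close>.
  Because \<open>w\<close> has the full degree of \<open>W\<close>, the quotient homogenizes to a form of complementary
  degree, so \<open>G\<close> is a multiple of \<open>W\<close>.
\<close>

lemma in_J_if_w_dvd_sub:
  assumes "w dvd sub h"
  shows "h \<in> J"
proof -
  obtain d G where G: "homogeneous (d * Suc (Suc k)) G" "(N * P) ^ d * h - G \<in> J"
      "w dvd on_lines 1 G - (N * p) ^ d * sub h"
    using cleared_exists[of h] unfolding cleared_def by blast
  have "w dvd (on_lines 1 G - (N * p) ^ d * sub h) + (N * p) ^ d * sub h"
    by (intro dvd_add dvd_mult G assms)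
  then obtain r where r: "on_lines 1 G = w * r" by auto
  have "G \<in> J"
  proof (cases "r = 0")
    case True
    then have "G = 0" using homogeneous_eqI[OF G(1) homogeneous_0] r by simp
    then show ?thesis using J_closed(3)[OF W_in_J, of 0] by simp
  next
    case False
    then have deg: "2 * k + 1 + degree r \<le> d * Suc (Suc k)"
      using degree_on_lines_1_le[OF G(1)] r w_nonzero by (simp add: degree_mult_eq degree_w)
    then have "degree r \<le> d * Suc (Suc k) - (2 * k + 1)" by simp
    then obtain R where R: "homogeneous (d * Suc (Suc k) - (2 * k + 1)) R" "on_lines 1 R = r"
      by (rule homogenization_exists)
    have "d * Suc (Suc k) - (2 * k + 1) + (2 * k + 1) = d * Suc (Suc k)"
      using deg by linarith
    then have "homogeneous (d * Suc (Suc k)) (R * W)"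
      using homogeneous_mult[OF R(1) homogeneous_W] by (simp only:)
    then have "G = R * W"
      by (rule homogeneous_eqI[OF G(1)]) (simp add: r R(2) on_lines_W on_lines.hom_mult)
    then show ?thesis using J_closed(3)[OF W_in_J] by simp
  qed
  then have "(N * P) ^ d * h \<in> J"
    using J_closed(1)[OF G(2)] by fastforce
  then have "const2 (1 / of_nat (Suc (Suc k)) ^ d) * ((N * P) ^ d * h) \<in> J"
    by (rule J_closed)
  moreover have "const2 (1 / of_nat (Suc (Suc k)) ^ d) * (N * P) ^ d = P ^ d"
  proof -
    have "const2 (1 / of_nat (Suc (Suc k)) ^ d) * N ^ d = const2 (1 / of_nat (Suc (Suc k)) ^ d * of_nat (Suc (Suc k)) ^ d)"
      by (simp only: const2_mult const2_power const2_of_nat)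
    also have "\<dots> = 1"
      by (simp add: const2_1 del: of_nat_Suc)
    finally show ?thesis
      by (simp only: power_mult_distrib mult.assoc[symmetric] mult_1)
  qed
  ultimately have "P ^ d * h \<in> J" by (simp only: mult.assoc[symmetric])
  then show ?thesis by (rule J_cancel)
qed

lemma in_J_iff: "h \<in> J \<longleftrightarrow> w dvd sub h"
  using in_J_if_w_dvd_sub w_dvd_sub_if_in_J by blast

text \<open>
  The slope \<open>y/x\<close> has a polynomial representative \<open>y c(x)\<close> modulo \<open>J\<close>, and its powers form a basis
  because they correspond to the powers of \<open>s\<close> modulo \<open>w\<close>.
\<close>

theorem quotient_dim_J: "quotient_dim_eq J (2 * k + 1)"
proof -
  obtain c where c: "w dvd t * (c \<circ>\<^sub>p t) - 1"
    using inverse_modulo[OF w_nonzero t_nonzero] by blast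
  define b where "b i = (vary * [:c:]) ^ i" for i :: nat
  have "sub (vary * [:c:]) - [:0, 1:] = [:0, 1:] * (t * (c \<circ>\<^sub>p t) - 1)"
    unfolding on_lines.hom_mult on_lines_vary on_lines_coeff_poly by (simp add: algebra_simps del: mult_pCons_left mult_pCons_right)
  then have slope: "w dvd sub (vary * [:c:]) - [:0, 1:]"
    using c by (metis dvd_mult)
  have b: "w dvd sub (b i) - [:0, 1:] ^ i" for i
  proof -
    have "sub (vary * [:c:]) - [:0, 1:] dvd sub (b i) - [:0, 1:] ^ i"
      unfolding b_def on_lines.hom_power by (metis power_diff_sumr2 dvd_triv_left)
    then show ?thesis using slope dvd_trans by blast
  qed
  have comb: "w dvd sub (\<Sum>i<2 * k + 1. const2 (a i) * b i) - (\<Sum>i<2 * k + 1. monom (a i) i)" for a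
  proof -
    have "monom (a i) i = [:a i:] * [:0, 1:] ^ i" for i
      by (simp add: monom_altdef)
    then have "sub (\<Sum>i<2 * k + 1. const2 (a i) * b i) - (\<Sum>i<2 * k + 1. monom (a i) i) =
        (\<Sum>i<2 * k + 1. [:a i:] * (sub (b i) - [:0, 1:] ^ i))"
      by (simp only: on_lines.hom_sum on_lines.hom_mult on_lines_const2 right_diff_distrib sum_subtractf)
    also have "w dvd \<dots>" by (intro dvd_sum dvd_mult b)
    finally show ?thesis .
  qed
  have "\<exists>a. h - (\<Sum>i<2 * k + 1. const2 (a i) * b i) \<in> J" for h
  proof -
    define r where "r = sub h mod w"
    define g where "g = (\<Sum>i<2 * k + 1. const2 (coeff r i) * b i)"
    have "degree r < 2 * k + 1 \<or> r = 0"
      using degree_mod_less[OF w_nonzero, of "sub h"] degree_w by (auto simp: r_def)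
    then have "degree r \<le> 2 * k" by auto
    then have "r = (\<Sum>i\<le>2 * k. monom (coeff r i) i)"
      by (rule poly_as_sum_of_monoms'[symmetric])
    also have "{..2 * k} = {..<2 * k + 1}" by auto
    finally have "w dvd sub g - r"
      using comb[of "coeff r"] by (simp add: g_def)
    moreover have "w dvd sub h - r"
      by (simp add: r_def minus_mod_eq_mult_div)
    ultimately have "w dvd (sub h - r) - (sub g - r)"
      by (rule dvd_diff[rotated])
    then have "h - g \<in> J"
      by (simp add: in_J_iff on_lines.hom_minus)
    then show ?thesis unfolding g_def by blast
  qed
  moreover have "\<forall>i<2 * k + 1. a i = 0" if "(\<Sum>i<2 * k + 1. const2 (a i) * b i) \<in> J" for a
  proof -
    let ?s = "\<Sum>i<2 * k + 1. monom (a i) i"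
    have "w dvd sub (\<Sum>i<2 * k + 1. const2 (a i) * b i)"
      using that by (simp add: in_J_iff)
    from dvd_diff[OF this comb[of a]] have "w dvd ?s" by simp
    moreover have coeff: "coeff ?s i = (if i < 2 * k + 1 then a i else 0)" for i
      by (simp add: coeff_sum)
    have "degree ?s < 2 * k + 1"
    proof (rule degree_lessI)
      show "\<forall>i\<ge>2 * k + 1. coeff ?s i = 0" unfolding coeff by simp
    qed simp
    ultimately have "?s = 0"
      using degree_w dvd_imp_degree_le[of w ?s] by linarith
    then show ?thesis using coeff by (metis coeff_0)
  qed
  ultimately show ?thesis unfolding quotient_dim_eq_def by blast
qed

end

section \<open>Functions depending polynomially on a parameter\<close>

text \<open>
  This is applied twice: to scalar functions that are polynomial in the coordinates, and to families of
  univariate polynomials whose coefficients are such functions. Determinants over both are needed: that of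
  the pencil has polynomial entries, that of the Sylvester matrix scalar ones.
\<close>

locale function_subring =
  fixes R :: "('v \<Rightarrow> 'a::comm_ring_1) set"
  assumes const: "(\<lambda>_. c) \<in> R"
    and add: "f \<in> R \<Longrightarrow> g \<in> R \<Longrightarrow> (\<lambda>v. f v + g v) \<in> R"
    and mult: "f \<in> R \<Longrightarrow> g \<in> R \<Longrightarrow> (\<lambda>v. f v * g v) \<in> R"
begin

lemma diff: "f \<in> R \<Longrightarrow> g \<in> R \<Longrightarrow> (\<lambda>v. f v - g v) \<in> R"
  using add[of f "\<lambda>v. - 1 * g v"] mult[of "\<lambda>_. - 1" g] const by simp

lemma sum: "(\<And>i. i \<in> I \<Longrightarrow> f i \<in> R) \<Longrightarrow> (\<lambda>v. \<Sum>i\<in>I. f i v) \<in> R"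
  by (induction I rule: infinite_finite_induct) (auto intro: add const)

lemma prod: "(\<And>i. i \<in> I \<Longrightarrow> f i \<in> R) \<Longrightarrow> (\<lambda>v. \<Prod>i\<in>I. f i v) \<in> R"
  by (induction I rule: infinite_finite_induct) (auto intro: mult const)

lemma det:
  assumes dim: "\<And>v. A v \<in> carrier_mat n n"
    and entry: "\<And>i j. i < n \<Longrightarrow> j < n \<Longrightarrow> (\<lambda>v. A v $$ (i, j)) \<in> R"
  shows "(\<lambda>v. det (A v)) \<in> R"
  unfolding det_def'[OF dim]
proof (intro sum mult const prod)
  fix \<pi> i assume "\<pi> \<in> {\<pi>. \<pi> permutes {0..<n}}" "i \<in> {0..<n}"
  then show "(\<lambda>v. A v $$ (i, \<pi> i)) \<in> R"
    using permutes_in_image[of \<pi> "{0..<n}" i] by (intro entry) auto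
qed

lemma cofactor:
  assumes dim: "\<And>v. A v \<in> carrier_mat n n"
    and entry: "\<And>i j. i < n \<Longrightarrow> j < n \<Longrightarrow> (\<lambda>v. A v $$ (i, j)) \<in> R"
  shows "(\<lambda>v. cofactor (A v) i j) \<in> R"
  unfolding cofactor_def
proof (intro mult const det[of "\<lambda>v. mat_delete (A v) i j" "n - 1"])
  show "mat_delete (A v) i j \<in> carrier_mat (n - 1) (n - 1)" for v
    using dim by (rule mat_delete_carrier)
  show "(\<lambda>v. mat_delete (A v) i j $$ (i', j')) \<in> R" if "i' < n - 1" "j' < n - 1" for i' j'
  proof -
    have "mat_delete (A v) i j $$ (i', j') =
        A v $$ (if i' < i then i' else Suc i', if j' < j then j' else Suc j')" for v
      using that dim[of v] by (auto simp: mat_delete_def)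
    then show ?thesis using that by (auto intro!: entry)
  qed
qed

end

lemma polynomial_functions_subring: "function_subring (polynomial_functions C)"
  by unfold_locales (auto intro: polynomial_functions.intros)

definition polynomial_families :: "('v \<Rightarrow> 'a::comm_ring_1) set \<Rightarrow> ('v \<Rightarrow> 'a poly) set" where
  "polynomial_families C = {F. \<forall>i. (\<lambda>v. coeff (F v) i) \<in> polynomial_functions C}"

lemma polynomial_families_subring: "function_subring (polynomial_families C)"
proof -
  interpret function_subring "polynomial_functions C" by (rule polynomial_functions_subring)
  show ?thesis
    by unfold_locales (auto simp: polynomial_families_def coeff_mult intro!: const add mult sum)
qed

lemma polynomial_families_coeff:
  "F \<in> polynomial_families C \<Longrightarrow> (\<lambda>v. coeff (F v) i) \<in> polynomial_functions C"
  by (simp add: polynomial_families_def)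

lemma polynomial_families_linear_poly:
  assumes "f \<in> polynomial_functions C" "g \<in> polynomial_functions C"
  shows "(\<lambda>v. [:f v, g v:]) \<in> polynomial_families C"
  unfolding polynomial_families_def
proof (intro CollectI allI)
  fix i
  show "(\<lambda>v. coeff [:f v, g v:] i) \<in> polynomial_functions C"
  proof (cases i)
    case (Suc i')
    then show ?thesis using assms polynomial_functions.const[of 0 C] by (cases i') auto
  qed (use assms in simp)
qed

lemma polynomial_families_const_poly:
  assumes "f \<in> polynomial_functions C"
  shows "(\<lambda>v. [:f v:]) \<in> polynomial_families C"
  using polynomial_families_linear_poly[OF assms polynomial_functions.const[of 0]] by simp

lemma polynomial_families_pderiv:
  "F \<in> polynomial_families C \<Longrightarrow> (\<lambda>v. pderiv (F v)) \<in> polynomial_families C"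
  by (auto simp: polynomial_families_def coeff_pderiv intro: polynomial_functions.intros)

text \<open>
  The size of the Sylvester matrix is fixed in advance, since the degrees of the two polynomials may drop for
  special parameters.
\<close>

lemma resultant_sub_polynomial:
  assumes "F \<in> polynomial_families C" "G \<in> polynomial_families C"
  shows "(\<lambda>v. resultant_sub m n (F v) (G v)) \<in> polynomial_functions C"
proof -
  interpret function_subring "polynomial_functions C" by (rule polynomial_functions_subring)
  show ?thesis
    unfolding resultant_sub_def
  proof (rule det[OF sylvester_mat_sub_carrier])
    fix i j assume ij: "i < m + n" "j < m + n"
    show "(\<lambda>v. sylvester_mat_sub m n (F v) (G v) $$ (i, j)) \<in> polynomial_functions C"
      unfolding sylvester_mat_sub_index[OF ij]
      by (cases "i < n"; cases "i \<le> j \<and> j - i \<le> m"; cases "i - n \<le> j \<and> j \<le> i")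
         (simp_all only: simp_thms if_True if_False const polynomial_families_coeff assms)
  qed
qed

section \<open>Determinant and trace on the pencil\<close>

definition pencil :: "nat \<Rightarrow> 'a::comm_ring_1 mat \<Rightarrow> 'a mat \<Rightarrow> 'a poly mat" where
  "pencil n A B = mat n n (\<lambda>(i, j). [:A $$ (i, j), B $$ (i, j):])"

lemma pencil_carrier [simp]: "pencil n A B \<in> carrier_mat n n"
  by (simp add: pencil_def)

text \<open>
  The trace of \<open>S adj (A + s B)\<close>, written out through the cofactors, to which the rules for determinants
  of parametrized matrices apply.
\<close>

definition pencil_trace :: "nat \<Rightarrow> 'a::comm_ring_1 mat \<Rightarrow> 'a mat \<Rightarrow> 'a mat \<Rightarrow> 'a poly" where
  "pencil_trace n A B S = (\<Sum>i<n. \<Sum>j<n. [:S $$ (i, j):] * cofactor (pencil n A B) i j)"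

text \<open>
  The first two coefficients make the degree of \<open>p q\<close> equal to \<open>2 k + 3\<close>, and the third that of \<open>w\<close> equal
  to \<open>2 k + 1\<close>, so that the Sylvester determinant of fixed size is the resultant whenever the
  product of the coefficients is nonzero.
\<close>

definition genericity :: "nat \<Rightarrow> complex mat \<Rightarrow> complex mat \<Rightarrow> complex mat \<Rightarrow> complex" where
  "genericity k A B S = (let p = det (pencil (k + 2) A B); q = pencil_trace (k + 2) A B S;
      w = critical_poly (k + 2) p q in
    coeff p (k + 2) * coeff q (k + 1) * coeff w (2 * k + 1) *
    resultant_sub (2 * k + 1) (2 * k + 3) w (p * q))"

lemma genericity_polynomial:
  assumes A: "\<And>i j. i < k + 2 \<Longrightarrow> j < k + 2 \<Longrightarrow> (\<lambda>v. A v $$ (i, j)) \<in> polynomial_functions C"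
    and B: "\<And>i j. i < k + 2 \<Longrightarrow> j < k + 2 \<Longrightarrow> (\<lambda>v. B v $$ (i, j)) \<in> polynomial_functions C"
    and S: "\<And>i j. i < k + 2 \<Longrightarrow> j < k + 2 \<Longrightarrow> (\<lambda>v. S v $$ (i, j)) \<in> polynomial_functions C"
  shows "(\<lambda>v. genericity k (A v) (B v) (S v)) \<in> polynomial_functions C"
proof -
  interpret pf: function_subring "polynomial_functions C" by (rule polynomial_functions_subring)
  interpret fam: function_subring "polynomial_families C" by (rule polynomial_families_subring)
  have entry: "(\<lambda>v. pencil (k + 2) (A v) (B v) $$ (i, j)) \<in> polynomial_families C"
    if "i < k + 2" "j < k + 2" for i j
    using that by (simp add: pencil_def polynomial_families_linear_poly A B)
  have p: "(\<lambda>v. det (pencil (k + 2) (A v) (B v))) \<in> polynomial_families C"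
    by (rule fam.det[OF pencil_carrier entry])
  have q: "(\<lambda>v. pencil_trace (k + 2) (A v) (B v) (S v)) \<in> polynomial_families C"
    unfolding pencil_trace_def
    by (intro fam.sum fam.mult polynomial_families_const_poly S fam.cofactor[OF pencil_carrier entry]) auto
  have w: "(\<lambda>v. critical_poly (k + 2) (det (pencil (k + 2) (A v) (B v)))
      (pencil_trace (k + 2) (A v) (B v) (S v))) \<in> polynomial_families C"
    unfolding critical_poly_def
    by (intro fam.diff fam.mult fam.const polynomial_families_pderiv p q)
  show ?thesis
    unfolding genericity_def Let_def
    by (intro pf.mult polynomial_families_coeff resultant_sub_polynomial fam.mult p q w)
qed

lemma homogeneous_det:
  fixes A :: "'a::comm_ring_1 poly poly mat"
  assumes A: "A \<in> carrier_mat n n"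
    and entry: "\<And>i j. i < n \<Longrightarrow> j < n \<Longrightarrow> homogeneous 1 (A $$ (i, j))"
  shows "homogeneous n (det A)"
  unfolding det_def'[OF A]
proof (rule homogeneous_sum)
  fix \<pi> assume "\<pi> \<in> {\<pi>. \<pi> permutes {0..<n}}"
  then have \<pi>: "\<pi> i < n" if "i < n" for i
    using that permutes_in_image[of \<pi> "{0..<n}" i] by auto
  have "homogeneous (\<Sum>i = 0..<n. 1) (\<Prod>i = 0..<n. A $$ (i, \<pi> i))"
    by (rule homogeneous_prod) (auto intro: entry[unfolded One_nat_def] \<pi>)
  then have prod: "homogeneous n (\<Prod>i = 0..<n. A $$ (i, \<pi> i))"
    by simp
  from signof_pm_one[of \<pi>] show "homogeneous n (signof \<pi> * (\<Prod>i = 0..<n. A $$ (i, \<pi> i)))"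
    using prod homogeneous_minus[OF prod] by (auto simp: sign_def)
qed

lemma homogeneous_cofactor:
  fixes A :: "'a::comm_ring_1 poly poly mat"
  assumes A: "A \<in> carrier_mat n n"
    and entry: "\<And>i j. i < n \<Longrightarrow> j < n \<Longrightarrow> homogeneous 1 (A $$ (i, j))"
  shows "homogeneous (n - 1) (cofactor A i j)"
proof -
  have "homogeneous 1 (mat_delete A i j $$ (i', j'))" if "i' < n - 1" "j' < n - 1" for i' j'
  proof -
    have "mat_delete A i j $$ (i', j') =
        A $$ (if i' < i then i' else Suc i', if j' < j then j' else Suc j')"
      using that A by (auto simp: mat_delete_def)
    then show ?thesis using that by (auto intro!: entry[unfolded One_nat_def])
  qed
  then have det: "homogeneous (n - 1) (det (mat_delete A i j))"
    using mat_delete_carrier[OF A] by (intro homogeneous_det)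
  show ?thesis
    unfolding cofactor_def using det homogeneous_minus[OF det]
    by (cases "even (i + j)") auto
qed

lemma (in comm_ring_hom) hom_cofactor:
  assumes "i < dim_row A" "j < dim_col A"
  shows "cofactor (map_mat hom A) i j = hom (cofactor A i j)"
proof -
  have "mat_delete (map_mat hom A) i j = map_mat hom (mat_delete A i j)"
    by (rule eq_matI) (use assms in \<open>auto simp: mat_delete_def\<close>)
  then show ?thesis by (simp add: cofactor_def hom_mult hom_power hom_uminus)
qed

lemma T_poly_eq:
  assumes "A \<in> carrier_mat n n" "B \<in> carrier_mat n n" "S \<in> carrier_mat n n"
  shows "T_poly A B S = (\<Sum>i<n. \<Sum>j<n. const2 (S $$ (i, j)) * cofactor (Sigma_poly A B) i j)"
proof -
  have "Sigma_poly A B \<in> carrier_mat n n"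
    using assms by (simp add: Sigma_poly_def)
  then show ?thesis
    using assms unfolding T_poly_def mat_trace_def
    by (auto simp: adj_mat_def scalar_prod_def lessThan_atLeast0 intro!: sum.cong)
qed

context
  fixes n :: nat and A B S :: "complex mat"
  assumes carrier: "A \<in> carrier_mat n n" "B \<in> carrier_mat n n" "S \<in> carrier_mat n n"
begin

lemma Sigma_carrier: "Sigma_poly A B \<in> carrier_mat n n"
  using carrier by (simp add: Sigma_poly_def)

lemma Sigma_entry:
  "i < n \<Longrightarrow> j < n \<Longrightarrow> Sigma_poly A B $$ (i, j) = varx * const2 (A $$ (i, j)) + vary * const2 (B $$ (i, j))"
  using carrier by (simp add: Sigma_poly_def)

lemma homogeneous_Sigma_entry: "i < n \<Longrightarrow> j < n \<Longrightarrow> homogeneous 1 (Sigma_poly A B $$ (i, j))"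
  using homogeneous_mult[OF homogeneous_varx homogeneous_const2]
    homogeneous_mult[OF homogeneous_vary homogeneous_const2]
  by (simp add: Sigma_entry homogeneous_add)

lemma homogeneous_P_poly: "homogeneous n (P_poly A B)"
  unfolding P_poly_def by (rule homogeneous_det[OF Sigma_carrier homogeneous_Sigma_entry])

lemma homogeneous_T_poly: "homogeneous (n - 1) (T_poly A B S)"
  unfolding T_poly_eq[OF carrier]
  using homogeneous_mult[OF homogeneous_const2 homogeneous_cofactor[OF Sigma_carrier homogeneous_Sigma_entry]]
  by (intro homogeneous_sum) simp

lemma Sigma_on_lines: "map_mat (on_lines 1) (Sigma_poly A B) = pencil n A B"
  by (rule eq_matI)
     (use Sigma_carrier in \<open>auto simp: Sigma_entry pencil_def on_lines.hom_add on_lines.hom_mult\<close>)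

lemma P_poly_on_lines: "on_lines 1 (P_poly A B) = det (pencil n A B)"
  unfolding P_poly_def Sigma_on_lines[symmetric] by (rule on_lines.hom_det[symmetric])

lemma T_poly_on_lines: "on_lines 1 (T_poly A B S) = pencil_trace n A B S"
  unfolding T_poly_eq[OF carrier] pencil_trace_def
  using Sigma_carrier
  by (simp add: on_lines.hom_sum on_lines.hom_mult on_lines.hom_cofactor flip: Sigma_on_lines)

end

section \<open>A generic triple\<close>

lemma resultant_nonzero_iff:
  fixes f g :: "complex poly"
  assumes "f \<noteq> 0"
  shows "resultant f g \<noteq> 0 \<longleftrightarrow> (\<forall>r. poly f r = 0 \<longrightarrow> poly g r \<noteq> 0)"
proof
  assume "resultant f g \<noteq> 0"
  then have deg: "degree (gcd f g) = 0" by (simp add: resultant_0_gcd)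
  show "\<forall>r. poly f r = 0 \<longrightarrow> poly g r \<noteq> 0"
  proof (intro allI impI notI)
    fix r assume "poly f r = 0" "poly g r = 0"
    then have "[:- r, 1:] dvd gcd f g" by (simp add: poly_eq_0_iff_dvd)
    then have "degree [:- r, 1:] \<le> degree (gcd f g)"
      using assms by (intro dvd_imp_degree_le) auto
    then show False using deg by simp
  qed
next
  assume no_common: "\<forall>r. poly f r = 0 \<longrightarrow> poly g r \<noteq> 0"
  have "degree (gcd f g) = 0"
  proof (rule ccontr)
    assume "degree (gcd f g) \<noteq> 0"
    then obtain r where "poly (gcd f g) r = 0"
      using fundamental_theorem_of_algebra constant_degree by metis
    then have "poly f r = 0" "poly g r = 0"
      by (metis poly_eq_0_iff_dvd dvd_trans gcd_dvd1, metis poly_eq_0_iff_dvd dvd_trans gcd_dvd2)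
    then show False using no_common by blast
  qed
  then show "resultant f g \<noteq> 0" by (simp add: resultant_0_gcd)
qed

lemma genericity_nonzero_iff:
  fixes k A B S
  defines "p \<equiv> det (pencil (k + 2) A B)" and "q \<equiv> pencil_trace (k + 2) A B S"
  defines "w \<equiv> critical_poly (k + 2) p q"
  assumes deg: "degree p \<le> k + 2" "degree q \<le> k + 1" "degree w \<le> 2 * k + 1"
  shows "genericity k A B S \<noteq> 0 \<longleftrightarrow> coeff p (k + 2) \<noteq> 0 \<and> coeff q (k + 1) \<noteq> 0 \<and>
    coeff w (2 * k + 1) \<noteq> 0 \<and> (\<forall>r. poly w r = 0 \<longrightarrow> poly p r \<noteq> 0 \<and> poly q r \<noteq> 0)"
proof (cases "coeff p (k + 2) \<noteq> 0 \<and> coeff q (k + 1) \<noteq> 0 \<and> coeff w (2 * k + 1) \<noteq> 0")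
  case True
  then have "degree p = k + 2" "degree q = k + 1" "degree w = 2 * k + 1"
    using deg le_degree[of p "k + 2"] le_degree[of q "k + 1"] le_degree[of w "2 * k + 1"] by auto
  moreover have "p \<noteq> 0" "q \<noteq> 0" "w \<noteq> 0" using True by auto
  ultimately have "resultant_sub (2 * k + 1) (2 * k + 3) w (p * q) = resultant w (p * q)"
    unfolding resultant_sub by (simp add: degree_mult_eq numeral_3_eq_3 mult_2)
  with True resultant_nonzero_iff[OF \<open>w \<noteq> 0\<close>, of "p * q"] show ?thesis
    by (auto simp: genericity_def p_def q_def w_def Let_def)
next
  case False
  then show ?thesis by (auto simp: genericity_def p_def q_def w_def Let_def)
qed

definition diagonal :: "nat \<Rightarrow> (nat \<Rightarrow> 'a::zero) \<Rightarrow> 'a mat" where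
  "diagonal n d = mat n n (\<lambda>(i, j). if i = j then d i else 0)"

lemma diagonal_symmetric: "diagonal n d \<in> sym_mats n"
  by (auto simp: sym_mats_def diagonal_def intro!: eq_matI)

lemma det_diagonal: "det (diagonal n d :: 'a::comm_ring_1 mat) = (\<Prod>i<n. d i)"
proof -
  have "upper_triangular (diagonal n d)" "diagonal n d \<in> carrier_mat n n"
    by (auto simp: diagonal_def)
  then have "det (diagonal n d) = prod_list (diag_mat (diagonal n d))"
    by (rule det_upper_triangular)
  also have "\<dots> = (\<Prod>i<n. d i)"
    by (simp add: prod_list_diag_prod diagonal_def lessThan_atLeast0)
  finally show ?thesis .
qed

text \<open>
  The expansion of the determinant along row \<open>i\<close> has a single term, from which \<open>d i\<close> is cancelled.
\<close>

lemma cofactor_diagonal: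
  fixes d :: "nat \<Rightarrow> 'a::idom"
  assumes i: "i < n" and d: "d i \<noteq> 0"
  shows "cofactor (diagonal n d) i i = (\<Prod>j\<in>{..<n} - {i}. d j)"
proof -
  have "det (diagonal n d) = (\<Sum>j<n. diagonal n d $$ (i, j) * cofactor (diagonal n d) i j)"
    by (rule laplace_expansion_row[OF _ i]) (simp add: diagonal_def)
  also have "\<dots> = (\<Sum>j<n. if i = j then d i * cofactor (diagonal n d) i i else 0)"
    by (rule sum.cong) (use i in \<open>auto simp: diagonal_def\<close>)
  also have "\<dots> = d i * cofactor (diagonal n d) i i"
    using i by simp
  finally have "d i * cofactor (diagonal n d) i i = (\<Prod>j<n. d j)"
    by (simp add: det_diagonal)
  also have "\<dots> = d i * (\<Prod>j\<in>{..<n} - {i}. d j)"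
    using i by (intro prod.remove) auto
  finally show ?thesis using d by simp
qed

lemma pencil_diagonal: "pencil n (diagonal n (\<lambda>i. - \<zeta> i)) (diagonal n (\<lambda>_. 1)) = diagonal n (\<lambda>i. [:- \<zeta> i, 1:])"
  by (rule eq_matI) (auto simp: pencil_def diagonal_def)

lemma pencil_trace_diagonal:
  fixes \<zeta> :: "nat \<Rightarrow> 'a::idom"
  shows "pencil_trace n (diagonal n (\<lambda>i. - \<zeta> i)) (diagonal n (\<lambda>_. 1)) (diagonal n c) =
    (\<Sum>i<n. [:c i:] * (\<Prod>j\<in>{..<n} - {i}. [:- \<zeta> j, 1:]))"
  unfolding pencil_trace_def pencil_diagonal
proof (rule sum.cong[OF refl])
  fix i assume i: "i \<in> {..<n}"
  let ?C = "cofactor (diagonal n (\<lambda>i. [:- \<zeta> i, 1:]))"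
  have "(\<Sum>j<n. [:diagonal n c $$ (i, j):] * ?C i j) =
      (\<Sum>j<n. if i = j then [:c i:] * ?C i i else 0)"
    by (rule sum.cong) (use i in \<open>auto simp: diagonal_def\<close>)
  also have "\<dots> = [:c i:] * (\<Prod>j\<in>{..<n} - {i}. [:- \<zeta> j, 1:])"
    using i by (simp add: cofactor_diagonal)
  finally show "(\<Sum>j<n. [:diagonal n c $$ (i, j):] * ?C i j) =
      [:c i:] * (\<Prod>j\<in>{..<n} - {i}. [:- \<zeta> j, 1:])" .
qed

text \<open>
  For diagonal \<open>S\<close> the trace is a combination of the Lagrange basis polynomials of the nodes \<open>\<zeta> 0, \<dots>\<close>.
\<close>

lemma pencil_trace_interpolation:
  fixes \<zeta> :: "nat \<Rightarrow> 'a::field" and Q :: "'a poly"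
  assumes inj: "inj_on \<zeta> {..<n}" and deg: "degree Q < n"
  obtains c where "pencil_trace n (diagonal n (\<lambda>i. - \<zeta> i)) (diagonal n (\<lambda>_. 1)) (diagonal n c) = Q"
proof
  let ?L = "\<lambda>i. \<Prod>j\<in>{..<n} - {i}. [:- \<zeta> j, 1:]"
  let ?c = "\<lambda>i. poly Q (\<zeta> i) / poly (?L i) (\<zeta> i)"
  have L_diag: "poly (?L i) (\<zeta> i) \<noteq> 0" if "i < n" for i
    using that inj by (auto simp: poly_prod inj_on_def)
  have L_off: "poly (?L i) (\<zeta> k) = 0" if "k < n" "k \<noteq> i" for i k
    using that by (auto simp: poly_prod intro!: prod_zero)
  have "(\<Sum>i<n. [:?c i:] * ?L i) = Q"
  proof (rule poly_eqI_degree[where A = "\<zeta> ` {..<n}"])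
    fix x assume "x \<in> \<zeta> ` {..<n}"
    then obtain k where k: "k < n" "x = \<zeta> k" by auto
    have "poly (\<Sum>i<n. [:?c i:] * ?L i) x = (\<Sum>i<n. if i = k then ?c k * poly (?L k) (\<zeta> k) else 0)"
      unfolding poly_sum by (rule sum.cong) (use k L_off in auto)
    then show "poly (\<Sum>i<n. [:?c i:] * ?L i) x = poly Q x"
      using k L_diag[of k] by simp
  next
    have card: "card (\<zeta> ` {..<n}) = n" using inj by (simp add: card_image)
    have "degree (?L i) \<le> n - 1" if "i < n" for i
      using degree_prod_sum_le[of "{..<n} - {i}" "\<lambda>j. [:- \<zeta> j, 1:]"] that by simp
    then have "degree (\<Sum>i<n. [:?c i:] * ?L i) \<le> n - 1"
      by (intro degree_sum_le) (auto intro: order.trans[OF degree_smult_le])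
    then show "degree (\<Sum>i<n. [:?c i:] * ?L i) < card (\<zeta> ` {..<n})"
      using deg card by linarith
    show "degree Q < card (\<zeta> ` {..<n})" using deg card by simp
  qed
  then show "pencil_trace n (diagonal n (\<lambda>i. - \<zeta> i)) (diagonal n (\<lambda>_. 1)) (diagonal n ?c) = Q"
    by (simp only: pencil_trace_diagonal)
qed

lemma prod_roots_of_unity:
  assumes n: "0 < n"
  shows "(\<Prod>j<n. [:- cis (2 * pi * real j / real n), 1:]) = monom 1 n - 1"
proof (rule poly_eqI_degree_lead_coeff[where A = "{z::complex. z ^ n = 1}" and n = n])
  let ?\<zeta> = "\<lambda>j. cis (2 * pi * real j / real n)"
  let ?p = "\<Prod>j<n. [:- ?\<zeta> j, 1:]"
  have deg: "degree ?p = n"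
    by (subst degree_prod_eq_sum_degree) auto
  then show "degree ?p \<le> n" by simp
  have "lead_coeff ?p = 1" by (simp add: lead_coeff_prod)
  then show "coeff ?p n = coeff (monom 1 n - 1) n" using deg n by simp
  show "n \<le> card {z::complex. z ^ n = 1}" using card_roots_unity_eq[OF n] by simp
  show "degree (monom 1 n - 1 :: complex poly) \<le> n"
    by (rule degree_diff_le) (auto simp: degree_monom_le)
  fix z :: complex assume z: "z \<in> {z. z ^ n = 1}"
  then have "z \<in> ?\<zeta> ` {..<n}"
    using bij_betw_roots_unity[OF n] by (simp add: bij_betw_def)
  then have "poly ?p z = 0" by (auto simp: poly_prod intro!: prod_zero)
  then show "poly ?p z = poly (monom 1 n - 1) z" using z by (simp add: poly_monom)
qed

text \<open>
  Here \<open>w = (k + 1) q p' - (k + 2) p q'\<close>. The coefficient of \<open>s\<^sup>n\<^sup>-\<^sup>1\<close> in \<open>p\<close> being zero, the leading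
  coefficient of \<open>w\<close> is \<open>n\<close> times the coefficient of \<open>s\<^sup>k\<close> in \<open>q\<close>, which is why \<open>q\<close> contains that
  monomial. The constant \<open>3\<close> exceeds \<open>|s\<^sup>k\<^sup>+\<^sup>1 + s\<^sup>k| \<le> 2\<close> on the closed unit disc and so pushes all roots
  of \<open>q\<close> outside, while those of \<open>p\<close> lie on the unit circle and those of \<open>q'\<close> lie inside. So \<open>p\<close> and \<open>q\<close> have no common root and \<open>q\<close>, like \<open>p\<close>, has only simple roots, which rules
  out common roots with \<open>w\<close>.
\<close>

lemma example_generic:
  fixes k :: nat
  defines "p \<equiv> monom 1 (k + 2) - 1 :: complex poly" and "q \<equiv> monom 1 (k + 1) + monom 1 k + [:3:]"
  defines "w \<equiv> critical_poly (k + 2) p q"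
  shows "degree p \<le> k + 2" "degree q \<le> k + 1" "degree w \<le> 2 * k + 1"
    "coeff p (k + 2) \<noteq> 0" "coeff q (k + 1) \<noteq> 0" "coeff w (2 * k + 1) \<noteq> 0"
    "\<And>r. poly w r = 0 \<Longrightarrow> poly p r \<noteq> 0 \<and> poly q r \<noteq> 0"
proof -
  show "degree p \<le> k + 2" unfolding p_def
    by (rule degree_diff_le) (auto simp: degree_monom_le)
  show "degree q \<le> k + 1" unfolding q_def
    by (intro degree_add_le) (auto simp: degree_monom_le intro: order.trans[OF degree_monom_le])
  show "coeff p (k + 2) \<noteq> 0" "coeff q (k + 1) \<noteq> 0" by (simp_all add: p_def q_def)
  have dp: "pderiv p = monom (of_nat (k + 2)) (k + 1)"
    by (simp add: p_def pderiv_diff pderiv_monom)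
  have coeff_w: "coeff w m = of_nat (k + 1) * coeff (pderiv p * q) m - of_nat (k + 2) * coeff (p * pderiv q) m" for m
    by (simp add: w_def critical_poly_def of_nat_poly mult.commute)
  have coeff1: "coeff (pderiv p * q) m = (if k + 1 \<le> m then of_nat (k + 2) * coeff q (m - (k + 1)) else 0)" for m
    unfolding dp by (simp add: coeff_monom_mult)
  have coeff2: "coeff (p * pderiv q) m = (if k + 2 \<le> m then coeff (pderiv q) (m - (k + 2)) else 0) - coeff (pderiv q) m" for m
    unfolding p_def by (simp add: left_diff_distrib coeff_monom_mult)
  have coeff_q: "coeff q j = (if j = k + 1 then 1 else 0) + (if j = k then 1 else 0) + (if j = 0 then 3 else 0)" for j
    by (auto simp: q_def coeff_pCons split: nat.splits)
  have top: "coeff w m = 0" if m: "2 * k + 1 < m" for m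
  proof -
    have "m = (m - (k + 2)) + (k + 2)"
      using m by simp
    then obtain i where i: "m = i + (k + 2)" ..
    then have "k \<le> i" using m by simp
    then show ?thesis unfolding coeff_w coeff1 coeff2
      by (simp add: i coeff_pderiv coeff_q)
  qed
  show "degree w \<le> 2 * k + 1" using top by (intro degree_le) auto
  have "coeff w (2 * k + 1) = of_nat (k + 2) * coeff q k"
  proof (cases k)
    case (Suc k')
    then show ?thesis unfolding coeff_w coeff1 coeff2
      by (simp add: coeff_pderiv coeff_q algebra_simps)
  qed (simp add: coeff_w coeff1 coeff2 coeff_pderiv coeff_q)
  moreover have "coeff q k \<noteq> 0" by (simp add: coeff_q)
  ultimately show "coeff w (2 * k + 1) \<noteq> 0"
    by (simp del: of_nat_Suc of_nat_add)
  have small: "poly q r \<noteq> 0" if "norm r \<le> 1" for r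
  proof
    assume "poly q r = 0"
    then have "r ^ (k + 1) + r ^ k + 3 = 0"
      by (simp add: q_def poly_monom)
    then have "r ^ (k + 1) + r ^ k = - 3"
      by (simp only: eq_neg_iff_add_eq_0)
    then have "norm (r ^ (k + 1) + r ^ k) = 3" by simp
    moreover have "norm (r ^ (k + 1) + r ^ k) \<le> norm r ^ (k + 1) + norm r ^ k"
      using norm_triangle_ineq[of "r ^ (k + 1)" "r ^ k"] by (simp only: norm_power)
    moreover have "norm r ^ (k + 1) \<le> 1" "norm r ^ k \<le> 1"
      using that by (auto intro!: power_le_one simp del: power_Suc)
    ultimately show False by linarith
  qed
  fix r assume "poly w r = 0"
  then have w: "of_nat (k + 1) * poly q r * poly (pderiv p) r = of_nat (k + 2) * poly p r * poly (pderiv q) r"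
    by (simp add: w_def critical_poly_def)
  have p: "poly p r \<noteq> 0"
  proof
    assume p0: "poly p r = 0"
    then have "r ^ (k + 2) = 1" by (simp add: p_def poly_monom)
    then have "norm r = 1"
      by (metis norm_one norm_power power_eq_1_iff add_2_eq_Suc' nat.distinct(1) norm_ge_zero)
    then have "poly q r \<noteq> 0" "r \<noteq> 0" using small by auto
    then show False using w p0 by (simp add: dp poly_monom del: of_nat_Suc)
  qed
  moreover have "poly q r \<noteq> 0"
  proof
    assume q0: "poly q r = 0"
    then have r: "1 < norm r" using small by force
    have "poly (pderiv q) r = 0" using w q0 p by (simp del: of_nat_Suc)
    then have "of_nat (k + 1) * r ^ k + of_nat k * r ^ (k - 1) = 0"
      by (simp add: q_def pderiv_add pderiv_monom poly_monom pderiv_pCons)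
    moreover have "r ^ k * (of_nat (k + 1) * r + of_nat k) =
        r * (of_nat (k + 1) * r ^ k + of_nat k * r ^ (k - 1))"
      by (cases k) (simp_all add: algebra_simps)
    ultimately have "r ^ k * (of_nat (k + 1) * r + of_nat k) = 0"
      by (simp only: mult_zero_right)
    then have "of_nat (k + 1) * r = - of_nat k"
      using r by (auto simp: add_eq_0_iff2)
    then have "norm (of_nat (k + 1) * r) = real k" by simp
    then have "real (k + 1) * norm r = real k" by (simp only: norm_mult norm_of_nat)
    moreover have "real (k + 1) * 1 < real (k + 1) * norm r"
      using r by (intro mult_strict_left_mono) auto
    ultimately show False by simp
  qed
  ultimately show "poly p r \<noteq> 0 \<and> poly q r \<noteq> 0" by blast
qed

lemma generic_triple_exists:
  obtains A B S where "A \<in> sym_mats (k + 2)" "B \<in> sym_mats (k + 2)" "S \<in> sym_mats (k + 2)"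
    "genericity k A B S \<noteq> 0"
proof -
  let ?n = "k + 2"
  let ?\<zeta> = "\<lambda>j. cis (2 * pi * real j / real ?n)"
  let ?A = "diagonal ?n (\<lambda>i. - ?\<zeta> i)" and ?B = "diagonal ?n (\<lambda>_. 1)"
  note ex = example_generic[of k]
  have "inj_on ?\<zeta> {..<?n}"
    using bij_betw_roots_unity[of ?n] unfolding bij_betw_def by simp
  moreover have "degree (monom 1 (k + 1) + monom 1 k + [:3:] :: complex poly) < ?n"
    using ex(2) by simp
  ultimately obtain c where c: "pencil_trace ?n ?A ?B (diagonal ?n c) =
      monom 1 (k + 1) + monom 1 k + [:3:]"
    by (rule pencil_trace_interpolation)
  have p: "det (pencil ?n ?A ?B) = monom 1 ?n - 1"
    unfolding pencil_diagonal det_diagonal by (rule prod_roots_of_unity) simp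
  have "genericity k ?A ?B (diagonal ?n c) \<noteq> 0"
    using ex by (subst genericity_nonzero_iff) (unfold p c, auto)
  then show ?thesis
    using that diagonal_symmetric by blast
qed

section \<open>The maximum likelihood degree\<close>

lemma has_ML_degree_if_generic:
  assumes A: "map_mat complex_of_real A \<in> sym_mats (k + 2)"
    and B: "map_mat complex_of_real B \<in> sym_mats (k + 2)"
    and S: "S \<in> sym_mats (k + 2)" "genericity k (map_mat complex_of_real A) (map_mat complex_of_real B) S \<noteq> 0"
  shows "has_ML_degree (k + 2) A B (2 * k + 1)"
proof -
  let ?A = "map_mat complex_of_real A" and ?B = "map_mat complex_of_real B"
  let ?V = "{S \<in> sym_mats (k + 2). genericity k ?A ?B S \<noteq> 0}"
  have "(\<lambda>S. genericity k ?A ?B S) \<in> polynomial_functions (mat_coords (k + 2))"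
    by (intro genericity_polynomial polynomial_functions.const polynomial_functions.coord)
       (auto simp: mat_coords_def)
  then have open_V: "zariski_open_in (sym_mats (k + 2)) (mat_coords (k + 2)) ?V"
    unfolding zariski_open_in_def by (intro exI[of _ "{\<lambda>S. genericity k ?A ?B S}"]) auto
  have "quotient_dim_eq (score_ideal ?A ?B S) (2 * k + 1)" if "S \<in> ?V" for S
  proof -
    from A B that have carrier: "?A \<in> carrier_mat (k + 2) (k + 2)" "?B \<in> carrier_mat (k + 2) (k + 2)"
      "S \<in> carrier_mat (k + 2) (k + 2)" by (auto simp: sym_mats_def)
    let ?P = "P_poly ?A ?B" and ?T = "T_poly ?A ?B S"
    interpret score_forms k ?P ?T
      using homogeneous_P_poly[OF carrier] homogeneous_T_poly[OF carrier] by unfold_locales simp_all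
    have p_eq: "p = det (pencil (k + 2) ?A ?B)" and q_eq: "q = pencil_trace (k + 2) ?A ?B S"
      unfolding p_def q_def using P_poly_on_lines[OF carrier] T_poly_on_lines[OF carrier] by auto
    have w_eq': "w = critical_poly (k + 2) (det (pencil (k + 2) ?A ?B)) (pencil_trace (k + 2) ?A ?B S)"
      by (simp add: w_def p_eq q_eq)
    have deg: "degree p \<le> k + 2" "degree q \<le> k + 1" "degree w \<le> 2 * k + 1"
      using degree_on_lines_1_le[OF P] degree_on_lines_1_le[OF T] degree_on_lines_1_le[OF homogeneous_W]
      by (simp_all add: p_def q_def on_lines_W)
    have "genericity k ?A ?B S \<noteq> 0" using that by simp
    then have gen: "coeff w (2 * k + 1) \<noteq> 0" "\<forall>r. poly w r = 0 \<longrightarrow> poly p r \<noteq> 0 \<and> poly q r \<noteq> 0"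
      using genericity_nonzero_iff[OF deg[unfolded w_eq' p_eq q_eq]] unfolding w_eq' p_eq q_eq by auto
    then interpret generic_score_forms k ?P ?T
      by unfold_locales auto
    have "score_ideal ?A ?B S = J"
      by (simp add: score_ideal_def J_def fx_def fy_def score_x_def score_y_def Let_def)
    then show ?thesis using quotient_dim_J by simp
  qed
  then show ?thesis
    unfolding has_ML_degree_def using open_V S by blast
qed

theorem theorem2p2:
  fixes n :: nat
  assumes "n \<ge> 2"
  shows "\<exists>U :: (complex mat \<times> complex mat) set.
    zariski_open_in (sym_mats n \<times> sym_mats n) (mat_pair_coords n) U \<and> U \<noteq> {} \<and>
    (\<forall>A B :: real mat.
      (map_mat complex_of_real A, map_mat complex_of_real B) \<in> U \<and> cov_model n A B \<noteq> {} \<longrightarrow>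
      has_ML_degree n A B (2 * n - 3))"
proof -
  define k where "k = n - 2"
  have n: "n = k + 2" "2 * n - 3 = 2 * k + 1" using assms by (simp_all add: k_def)
  let ?C = "mat_pair_coords n :: (complex mat \<times> complex mat \<Rightarrow> complex) set"
  \<comment> \<open>One equation for every symmetric \<open>S\<close>: a pair is excluded only if all of them vanish.\<close>
  let ?F = "{(\<lambda>(A, B). genericity k A B S) | S. S \<in> sym_mats n}"
  let ?U = "{(A, B). A \<in> sym_mats n \<and> B \<in> sym_mats n \<and> (\<exists>S\<in>sym_mats n. genericity k A B S \<noteq> 0)}"
  have coords: "(\<lambda>v. fst v $$ (i, j)) \<in> ?C" "(\<lambda>v. snd v $$ (i, j)) \<in> ?C"
    if "i < n" "j < n" for i j
  proof -
    have entry: "(\<lambda>M :: complex mat. M $$ (i, j)) \<in> mat_coords n"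
      using that by (auto simp: mat_coords_def)
    show "(\<lambda>v. fst v $$ (i, j)) \<in> ?C" "(\<lambda>v. snd v $$ (i, j)) \<in> ?C"
      using imageI[OF entry, of "\<lambda>x. x \<circ> (fst :: complex mat \<times> complex mat \<Rightarrow> _)"] imageI[OF entry, of "\<lambda>x. x \<circ> (snd :: complex mat \<times> complex mat \<Rightarrow> _)"]
      by (simp_all add: mat_pair_coords_def o_def)
  qed
  have "(\<lambda>v. genericity k (fst v) (snd v) S) \<in> polynomial_functions (mat_pair_coords n)" for S
    by (intro genericity_polynomial polynomial_functions.const polynomial_functions.coord coords)
       (auto simp: n)
  then have "?F \<subseteq> polynomial_functions (mat_pair_coords n)"
    by (auto simp: case_prod_unfold)
  moreover have "?U = sym_mats n \<times> sym_mats n - {v \<in> sym_mats n \<times> sym_mats n. \<forall>f\<in>?F. f v = 0}"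
    by auto
  ultimately have "zariski_open_in (sym_mats n \<times> sym_mats n) (mat_pair_coords n) ?U"
    unfolding zariski_open_in_def by blast
  moreover obtain A B S where "A \<in> sym_mats n" "B \<in> sym_mats n" "S \<in> sym_mats n"
      "genericity k A B S \<noteq> 0"
    using generic_triple_exists[of k] unfolding n(1) .
  then have "(A, B) \<in> ?U" by auto
  then have "?U \<noteq> {}" by (metis empty_iff)
  moreover have "has_ML_degree n A B (2 * n - 3)"
    if U: "(map_mat complex_of_real A, map_mat complex_of_real B) \<in> ?U" for A B
  proof -
    from U obtain S where "S \<in> sym_mats n"
        "genericity k (map_mat complex_of_real A) (map_mat complex_of_real B) S \<noteq> 0"
      by auto
    moreover from U have "map_mat complex_of_real A \<in> sym_mats n" "map_mat complex_of_real B \<in> sym_mats n"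
      by auto
    ultimately show ?thesis
      using has_ML_degree_if_generic[of A k B S] unfolding n(2) unfolding n(1) by simp
  qed
  ultimately show ?thesis by (intro exI[of _ ?U]) simp
qed

end
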